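(* Let $-\infty\le a<b\le\infty$ and let $\varrho,\varsigma,\chi$ be locally finite complex Borel measures on $(a,b)$ with $\operatorname{supp}(\varsigma)=(a,b)$ and $\varsigma(\{x\})\varrho(\{x\})=\varsigma(\{x\})\chi(\{x\})=0$ for all $x\in(a,b)$. Let $g\in L^1_{loc}((a,b);|\varrho|)$, $c\in(a,b)$, $d_1,d_2\in\mathbb{C}$, and for each $z\in\mathbb{C}$ let $f_z\in\mathfrak{D}_\tau$ be the unique solution of $(\tau-z)f=g$ with $f(c)=d_1$, $f^{[1]}(c)=d_2$. Then for each $x\in(a,b)$, $z\mapsto f_z(x)$ and $z\mapsto f_z^{[1]}(x)$ are entire functions of order $\tfrac12$. Moreover, for all $\alpha,\beta\in(a,b)$ with $\alpha<\beta$ there are constants $C,B\in\mathbb{R}$ such that $$|f_z(x)|+|f_z^{[1]}(x)|\le C\,e^{B\sqrt{|z|}},\qquad x\in[\alpha,\beta],\ z\in\mathbb{C}.$$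
   Context: For a locally finite complex Borel measure $\mu$ on $(a,b)$: $\int_c^x h\,d\mu=\int_{[c,x)}h\,d\mu$ if $x>c$, $0$ if $x=c$, $-\int_{[x,c)}h\,d\mu$ if $x<c$. $AC_{loc}((a,b);\mu)$ is the set of functions $f(x)=f(c)+\int_c^x h\,d\mu$ with $h\in L^1_{loc}((a,b);|\mu|)$, $h=\frac{df}{d\mu}$. $\mathfrak{D}_\tau$ is the set of $f\in AC_{loc}((a,b);\varsigma)$ for which there is $F\in AC_{loc}((a,b);\varrho)$ with $F(x)=-\frac{df}{d\varsigma}(x)+\int_c^x f\,d\chi$ for $|\varsigma|$-a.e. $x$; $F$ is unique, $\tau f:=\frac{dF}{d\varrho}$, and $f^{[1]}(x):=\int_c^x f\,d\chi-F(x)$. "$(\tau-z)f=g$" means $\tau f-zf=g$ $|\varrho|$-a.e. (Under the stated assumptions such initial value problems are uniquely solvable.)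
   Formalization: "Entire functions of order 1/2" is proved as "entire functions of order at most 1/2"; exact order 1/2 fails in general, for example at x = c, where f_z(c) = d_1 is constant in z and has order 0. *)

theory Defs
  imports "HOL-Analysis.Analysis"
begin

text \<open>A locally finite complex Borel measure on the open interval I = (a,b) is
represented by its polar decomposition: a pair (nu, h) where nu = |mu| is a positive,
locally finite Borel measure on the reals carried by I, and h is a Borel function
with |h| = 1 nu-a.e.; then mu(B) = integral over B of h d nu.\<close>

type_synonym cmeasure = "real measure \<times> (real \<Rightarrow> complex)"

definition ointerval :: "ereal \<Rightarrow> ereal \<Rightarrow> real set" where
  "ointerval a b = {x::real. a < ereal x \<and> ereal x < b}"

definition loc_fin_cmeasure :: "real set \<Rightarrow> cmeasure \<Rightarrow> bool" where
  "loc_fin_cmeasure I \<mu> \<longleftrightarrow>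
     sets (fst \<mu>) = sets borel \<and>
     emeasure (fst \<mu>) (UNIV - I) = 0 \<and>
     (\<forall>K. compact K \<and> K \<subseteq> I \<longrightarrow> emeasure (fst \<mu>) K < \<infinity>) \<and>
     snd \<mu> \<in> borel_measurable borel \<and>
     (AE t in fst \<mu>. norm (snd \<mu> t) = 1)"

definition cmeasure_val :: "cmeasure \<Rightarrow> real set \<Rightarrow> complex" where
  "cmeasure_val \<mu> B = set_lebesgue_integral (fst \<mu>) B (snd \<mu>)"

definition cm_support :: "real set \<Rightarrow> cmeasure \<Rightarrow> real set" where
  "cm_support I \<mu> = {x \<in> I. \<forall>e>0. emeasure (fst \<mu>) (ball x e \<inter> I) > 0}"

definition cint :: "cmeasure \<Rightarrow> real \<Rightarrow> real \<Rightarrow> (real \<Rightarrow> complex) \<Rightarrow> complex" where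
  "cint \<mu> c x f =
     (if c < x then set_lebesgue_integral (fst \<mu>) {c..<x} (\<lambda>t. f t * snd \<mu> t)
      else if x = c then 0
      else - set_lebesgue_integral (fst \<mu>) {x..<c} (\<lambda>t. f t * snd \<mu> t))"

definition loc_L1 :: "real set \<Rightarrow> cmeasure \<Rightarrow> (real \<Rightarrow> complex) \<Rightarrow> bool" where
  "loc_L1 I \<mu> h \<longleftrightarrow> (\<forall>\<alpha>\<in>I. \<forall>\<beta>\<in>I. set_integrable (fst \<mu>) {\<alpha>..\<beta>} h)"

definition ac_density :: "real set \<Rightarrow> cmeasure \<Rightarrow> real \<Rightarrow> (real \<Rightarrow> complex) \<Rightarrow> (real \<Rightarrow> complex) \<Rightarrow> bool" where
  "ac_density I \<mu> c f h \<longleftrightarrow> loc_L1 I \<mu> h \<and> (\<forall>x\<in>I. f x = f c + cint \<mu> c x h)"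

definition quasi_deriv :: "cmeasure \<Rightarrow> real \<Rightarrow> (real \<Rightarrow> complex) \<Rightarrow> (real \<Rightarrow> complex) \<Rightarrow> real \<Rightarrow> complex" where
  "quasi_deriv chi c f F x = cint chi c x f - F x"

text \<open>f \<in> D_tau with associated (unique) function F, and f solves (tau - z) f = g
  with f(c) = d1, f^[1](c) = d2.  Here h = df/d varvsig and k = dF/d varrho = tau f.\<close>
definition is_ivp_solution ::
  "real set \<Rightarrow> cmeasure \<Rightarrow> cmeasure \<Rightarrow> cmeasure \<Rightarrow> real \<Rightarrow> (real \<Rightarrow> complex) \<Rightarrow> complex
    \<Rightarrow> complex \<Rightarrow> complex \<Rightarrow> (real \<Rightarrow> complex) \<Rightarrow> (real \<Rightarrow> complex) \<Rightarrow> bool" where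
  "is_ivp_solution I rho vsig chi c g z d1 d2 f F \<longleftrightarrow>
     (\<exists>h k. ac_density I vsig c f h \<and> ac_density I rho c F k \<and>
        (AE x in fst vsig. x \<in> I \<longrightarrow> F x = - h x + cint chi c x f) \<and>
        (AE x in fst rho. x \<in> I \<longrightarrow> k x - z * f x = g x) \<and>
        f c = d1 \<and> quasi_deriv chi c f F c = d2)"

definition entire_order :: "(complex \<Rightarrow> complex) \<Rightarrow> ereal" where
  "entire_order F = Inf {ereal \<rho> | \<rho>. \<rho> \<ge> 0 \<and>
      (\<forall>\<^sub>F z in at_infinity. norm (F z) \<le> exp (norm z powr \<rho>))}"

end

theory Submission
  imports Defs
begin

text \<open>The solution and its quasi-derivative satisfy \<open>u = p + \<integral> v d\<varsigma>\<close>,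
  \<open>v = q + \<integral> u d\<chi> - z \<integral> u d\<rho>\<close>. With \<open>r\<close> of the size of \<open>sqrt \<bar>z\<bar>\<close>, the quantity
  \<open>\<bar>u\<bar> + \<bar>v\<bar> / r\<close> obeys a Gronwall inequality with kernel \<open>r\<close> times the total variation of the three
  measures, which gives growth \<open>exp (B * sqrt \<bar>z\<bar>)\<close>. Difference quotients in \<open>z\<close> solve the
  same kind of system, so the same estimate shows that they converge.\<close>

section \<open>A Gronwall inequality for set functions with atoms\<close>

text \<open>The obstacle is the atoms. For large \<open>z\<close> the factor \<open>r\<close> times
  a point mass exceeds 1, and an inequality that weights the unknown value at \<open>x\<close> by
  the mass of \<open>x\<close> then gives no information. To the right of \<open>c\<close> this does
  not happen, since the integrals run over \<open>[c,x)\<close>; to the left they run over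
  \<open>[x,c)\<close> and \<open>x\<close> itself is charged. The absence of common atoms repairs
  this. The jump from \<open>(u,v)\<close> at \<open>x\<close> to its right limit is a triangular
  map with ones on the diagonal, for every \<open>z\<close>. So the right limits can be estimated
  instead, and the jump is inverted at the cost of a factor polynomial in \<open>r\<close>, which
  the exponential absorbs without changing the order. The solutions are given rather than
  constructed as a series in \<open>z\<close>, so analyticity too has to come out of the a priori
  estimate. For this reason the estimate allows arbitrary bounded source terms.\<close>

lemma exp_increment_bound:
  fixes u v a b :: real
  assumes "v \<le> u + a * u + b * v" "0 \<le> u" "0 \<le> v" "0 \<le> a" "0 \<le> b" "b \<le> 1/2"
  shows "v \<le> u * exp (2 * (a + b))"
proof -
  have "v * (1 - b) \<le> u * (1 + a)"
    using assms(1) by (simp add: algebra_simps)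
  \<comment> \<open>The implicit term is solved for by dividing by \<open>1 - b\<close>;
    \<open>b \<le> 1/2\<close> gives \<open>1 / (1 - b) \<le> 1 + 2 * b\<close>. Both the threshold
    1/2 and the factor 2 in the exponent of all later bounds come from here.\<close>
  moreover have "1 \<le> (1 - b) * (1 + 2 * b)"
  proof -
    have "0 \<le> b * (1 - 2 * b)" using assms by (intro mult_nonneg_nonneg) auto
    then show ?thesis by (simp add: algebra_simps)
  qed
  ultimately have "v * 1 \<le> v * ((1 - b) * (1 + 2 * b))" "v * (1 - b) * (1 + 2 * b) \<le> u * (1 + a) * (1 + 2 * b)"
    using assms by (auto intro!: mult_left_mono mult_right_mono simp del: mult_1_right)
  then have "v \<le> u * (1 + a) * (1 + 2 * b)" by (simp only: mult.assoc mult_1_right)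
  also have "\<dots> \<le> u * (exp (2 * a) * exp (2 * b))"
  proof -
    have "1 + a \<le> exp (2 * a)" using exp_ge_add_one_self[of "2 * a"] assms by linarith
    then have "(1 + a) * (1 + 2 * b) \<le> exp (2 * a) * exp (2 * b)"
      using exp_ge_add_one_self[of "2 * b"] assms by (intro mult_mono) auto
    then show ?thesis using assms by (simp add: mult_left_mono mult.assoc)
  qed
  finally show ?thesis by (simp add: exp_add[symmetric] algebra_simps)
qed

text \<open>Because \<open>m\<close> may have large atoms, an atom is charged to the value of \<open>E\<close> before it,
  and only the open remainder, which is locally small, to the value after it.\<close>

lemma gronwall_forward:
  fixes E :: "real \<Rightarrow> real" and m :: "real set \<Rightarrow> real"
  assumes pq: "p \<le> q"
    and E0: "\<And>x. p \<le> x \<Longrightarrow> x \<le> q \<Longrightarrow> 0 \<le> E x"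
    and m0: "\<And>A. 0 \<le> m A"
    and split: "\<And>s t. p \<le> s \<Longrightarrow> s < t \<Longrightarrow> t \<le> q \<Longrightarrow> m {s..<t} = m {s} + m {s<..<t}"
    and add: "\<And>r s t. p \<le> r \<Longrightarrow> r \<le> s \<Longrightarrow> s \<le> t \<Longrightarrow> t \<le> q \<Longrightarrow> m {r..<t} = m {r..<s} + m {s..<t}"
    and small: "\<And>x. p \<le> x \<Longrightarrow> x \<le> q \<Longrightarrow> \<exists>d>0. \<forall>t.
        (x < t \<and> t < x + d \<and> t \<le> q \<longrightarrow> m {x<..<t} \<le> 1/2) \<and>
        (x - d < t \<and> t < x \<and> p \<le> t \<longrightarrow> m {t<..<x} \<le> 1/2)"
    and inc: "\<And>s t. p \<le> s \<Longrightarrow> s < t \<Longrightarrow> t \<le> q \<Longrightarrow>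
        E t \<le> E s + m {s} * E s + m {s<..<t} * E t"
  shows "E q \<le> E p * exp (2 * m {p..<q})"
proof -
  let ?P = "\<lambda>s t. p \<le> s \<longrightarrow> t \<le> q \<longrightarrow> E t \<le> E s * exp (2 * m {s..<t})"
  have refl: "E x \<le> E x * exp (2 * m {x..<x})" if "p \<le> x" "x \<le> q" for x
    using mult_left_mono[OF one_le_exp_iff[THEN iffD2] E0[OF that], of "2 * m {x..<x}"] m0[of "{x..<x}"]
    by simp
  have step: "E t \<le> E s * exp (2 * m {s..<t})"
    if "p \<le> s" "s < t" "t \<le> q" "m {s<..<t} \<le> 1/2" for s t
    using exp_increment_bound[OF inc[OF that(1-3)], OF E0 E0 m0 m0 that(4)] split[OF that(1-3)] that
    by simp
  have trans: "E c \<le> E a * exp (2 * m {a..<c})"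
    if "p \<le> a" "a \<le> b" "b \<le> c" "c \<le> q"
      and ab: "E b \<le> E a * exp (2 * m {a..<b})" and bc: "E c \<le> E b * exp (2 * m {b..<c})" for a b c
  proof -
    have "E c \<le> E a * exp (2 * m {a..<b}) * exp (2 * m {b..<c})"
      using bc mult_right_mono[OF ab exp_ge_zero] by (rule order_trans)
    also have "\<dots> = E a * exp (2 * m {a..<c})"
      unfolding add[OF that(1-4)] by (simp add: exp_add distrib_left mult.assoc)
    finally show ?thesis .
  qed
  \<comment> \<open>The estimate passes to concatenated intervals, so bisection reduces it to short
    intervals around each \<open>x\<close>. Such an interval is cut at \<open>x\<close>: both open
    pieces avoid the atom at \<open>x\<close> and are therefore small, however heavy that atom
    is.\<close>
  have "?P p q"
  proof (rule Bolzano[where P = ?P, OF pq])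
    fix a b c :: real
    assume "?P a b" "?P b c" "a \<le> b" "b \<le> c"
    then show "?P a c" using trans[of a b c] by auto
  next
    fix x assume x: "p \<le> x" "x \<le> q"
    obtain d where d: "d > 0" "\<And>t. x < t \<Longrightarrow> t < x + d \<Longrightarrow> t \<le> q \<Longrightarrow> m {x<..<t} \<le> 1/2"
      "\<And>t. x - d < t \<Longrightarrow> t < x \<Longrightarrow> p \<le> t \<Longrightarrow> m {t<..<x} \<le> 1/2"
      using small[OF x] by blast
    show "\<exists>d>0. \<forall>a b. a \<le> x \<and> x \<le> b \<and> b - a < d \<longrightarrow> ?P a b"
    proof (intro exI[of _ d] conjI allI impI d(1))
      fix a b assume ab: "a \<le> x \<and> x \<le> b \<and> b - a < d" "p \<le> a" "b \<le> q"
      have "E x \<le> E a * exp (2 * m {a..<x})"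
        using refl[OF x] step[of a x] d(3)[of a] ab x by (cases "a = x") auto
      moreover have "E b \<le> E x * exp (2 * m {x..<b})"
        using refl[OF x] step[of x b] d(2)[of b] ab x by (cases "b = x") auto
      ultimately show "E b \<le> E a * exp (2 * m {a..<b})"
        using trans[of a x b] ab by auto
    qed
  qed
  then show ?thesis by simp
qed

text \<open>The reflection \<open>x \<mapsto> -x\<close> of the forward version. It exchanges the
  two kinds of half-open interval, so an atom is now charged to the value at its right end, which is
  the known one when moving left.\<close>

lemma gronwall_backward:
  fixes E :: "real \<Rightarrow> real" and m :: "real set \<Rightarrow> real"
  assumes pq: "p \<le> q"
    and E0: "\<And>x. p \<le> x \<Longrightarrow> x \<le> q \<Longrightarrow> 0 \<le> E x"
    and m0: "\<And>A. 0 \<le> m A"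
    and split: "\<And>s t. p \<le> s \<Longrightarrow> s < t \<Longrightarrow> t \<le> q \<Longrightarrow> m {s<..t} = m {t} + m {s<..<t}"
    and add: "\<And>r s t. p \<le> r \<Longrightarrow> r \<le> s \<Longrightarrow> s \<le> t \<Longrightarrow> t \<le> q \<Longrightarrow> m {r<..t} = m {r<..s} + m {s<..t}"
    and small: "\<And>x. p \<le> x \<Longrightarrow> x \<le> q \<Longrightarrow> \<exists>d>0. \<forall>t.
        (x < t \<and> t < x + d \<and> t \<le> q \<longrightarrow> m {x<..<t} \<le> 1/2) \<and>
        (x - d < t \<and> t < x \<and> p \<le> t \<longrightarrow> m {t<..<x} \<le> 1/2)"
    and inc: "\<And>s t. p \<le> s \<Longrightarrow> s < t \<Longrightarrow> t \<le> q \<Longrightarrow>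
        E s \<le> E t + m {t} * E t + m {s<..<t} * E s"
  shows "E p \<le> E q * exp (2 * m {p<..q})"
proof -
  have "E (- (- p)) \<le> E (- (- q)) * exp (2 * m (uminus ` {-q..<-p}))"
  proof (rule gronwall_forward[where E = "\<lambda>x. E (- x)" and m = "\<lambda>A. m (uminus ` A)"])
    fix s t assume st: "-q \<le> s" "s < t" "t \<le> -p"
    show "m (uminus ` {s..<t}) = m (uminus ` {s}) + m (uminus ` {s<..<t})"
      using split[of "-t" "-s"] st by simp
    show "E (- t) \<le> E (- s) + m (uminus ` {s}) * E (- s) + m (uminus ` {s<..<t}) * E (- t)"
      using inc[of "-t" "-s"] st by simp
  next
    fix r s t assume "-q \<le> r" "r \<le> s" "s \<le> t" "t \<le> -p"
    then show "m (uminus ` {r..<t}) = m (uminus ` {r..<s}) + m (uminus ` {s..<t})"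
      using add[of "-t" "-s" "-r"] by simp
  next
    fix x assume x: "-q \<le> x" "x \<le> -p"
    obtain d where d: "d > 0" "\<And>t. -x < t \<Longrightarrow> t < -x + d \<Longrightarrow> t \<le> q \<Longrightarrow> m {-x<..<t} \<le> 1/2"
      "\<And>t. -x - d < t \<Longrightarrow> t < -x \<Longrightarrow> p \<le> t \<Longrightarrow> m {t<..<-x} \<le> 1/2"
      using small[of "-x"] x by fastforce
    show "\<exists>d>0. \<forall>t. (x < t \<and> t < x + d \<and> t \<le> -p \<longrightarrow> m (uminus ` {x<..<t}) \<le> 1/2) \<and>
        (x - d < t \<and> t < x \<and> -q \<le> t \<longrightarrow> m (uminus ` {t<..<x}) \<le> 1/2)"
      using d(1) d(2)[of "-t" for t] d(3)[of "-t" for t]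
      by (intro exI[of _ d]) auto
  qed (use E0 m0 pq in auto)
  then show ?thesis by simp
qed

section \<open>Locally finite measures and integral inequalities\<close>

text \<open>A locally finite measure on an open interval may have infinite mass near the ends, so
  finiteness is recorded on one compact interval only, where all estimates take place.\<close>

definition finite_on :: "real \<Rightarrow> real \<Rightarrow> real measure \<Rightarrow> bool" where
  "finite_on \<alpha> \<beta> M \<longleftrightarrow> sets M = sets borel \<and> emeasure M {\<alpha>..\<beta>} < \<infinity>"

lemma finite_on_sets: "finite_on \<alpha> \<beta> M \<Longrightarrow> sets M = sets borel"
  by (simp add: finite_on_def)

lemma finite_on_space: "finite_on \<alpha> \<beta> M \<Longrightarrow> space M = UNIV"
  using sets_eq_imp_space_eq[of M borel] by (simp add: finite_on_def)

lemma finite_on_measurable: "finite_on \<alpha> \<beta> M \<Longrightarrow> borel_measurable M = borel_measurable borel"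
  by (rule measurable_cong_sets) (simp_all add: finite_on_sets)

lemma finite_on_subset:
  assumes "finite_on \<alpha> \<beta> M" "A \<in> sets borel" "A \<subseteq> {\<alpha>..\<beta>}"
  shows "emeasure M A < \<infinity>"
proof -
  have "emeasure M A \<le> emeasure M {\<alpha>..\<beta>}"
    using assms by (intro emeasure_mono) (auto simp: finite_on_sets)
  then show ?thesis using assms(1) unfolding finite_on_def by (meson le_less_trans)
qed

lemma finite_on_fmeasurable:
  assumes "finite_on \<alpha> \<beta> M" "A \<in> sets borel" "A \<subseteq> {\<alpha>..\<beta>}"
  shows "A \<in> fmeasurable M"
  using assms finite_on_subset[OF assms] by (intro fmeasurableI) (auto simp: finite_on_sets[OF assms(1)])

lemma finite_on_measure_mono:
  assumes "finite_on \<alpha> \<beta> M" "A \<in> sets borel" "B \<in> sets borel" "A \<subseteq> B" "B \<subseteq> {\<alpha>..\<beta>}"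
  shows "measure M A \<le> measure M B"
  using assms by (intro measure_mono_fmeasurable finite_on_fmeasurable) (auto simp: finite_on_sets[OF assms(1)])

lemma finite_on_measure_Un:
  assumes "finite_on \<alpha> \<beta> M" "A \<in> sets borel" "B \<in> sets borel" "A \<inter> B = {}" "A \<union> B \<subseteq> {\<alpha>..\<beta>}"
  shows "measure M (A \<union> B) = measure M A + measure M B"
  using assms finite_on_subset[OF assms(1), of A] finite_on_subset[OF assms(1), of B]
  by (intro measure_Union) (auto simp: finite_on_sets[OF assms(1)])

text \<open>Cutting off outside the compact interval gives a genuine finite measure. This supplies
  the countability of atoms and the measurability of integrals depending on a parameter.\<close>

lemma finite_on_density:
  assumes "finite_on \<alpha> \<beta> M"
  shows "finite_measure (density M (indicator {\<alpha>..\<beta>}))"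
proof
  have "emeasure (density M (indicator {\<alpha>..\<beta>})) (space M) = emeasure M {\<alpha>..\<beta>}"
    using assms by (subst emeasure_density) (auto simp: finite_on_measurable finite_on_sets finite_on_space)
  then show "emeasure (density M (indicator {\<alpha>..\<beta>})) (space (density M (indicator {\<alpha>..\<beta>}))) \<noteq> \<infinity>"
    using assms unfolding finite_on_def space_density by (metis less_irrefl)
qed

lemma finite_on_countable_atoms:
  assumes M: "finite_on \<alpha> \<beta> M"
  shows "countable {x \<in> {\<alpha>..\<beta>}. measure M {x} \<noteq> 0}"
proof (rule countable_subset[OF _ finite_measure.countable_support[OF finite_on_density[OF M]]])
  have "emeasure (density M (indicator {\<alpha>..\<beta>})) {x} = emeasure M {x}" if "x \<in> {\<alpha>..\<beta>}" for x
  proof -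
    have "emeasure (density M (indicator {\<alpha>..\<beta>})) {x} = (\<integral>\<^sup>+ t. indicator {\<alpha>..\<beta>} t * indicator {x} t \<partial>M)"
      by (subst emeasure_density) (auto simp: finite_on_measurable[OF M] finite_on_sets[OF M])
    also have "\<dots> = (\<integral>\<^sup>+ t. indicator {x} t \<partial>M)"
      using that by (intro nn_integral_cong) (auto split: split_indicator)
    finally show ?thesis by (simp add: finite_on_sets[OF M])
  qed
  then show "{x \<in> {\<alpha>..\<beta>}. measure M {x} \<noteq> 0} \<subseteq> {x. measure (density M (indicator {\<alpha>..\<beta>})) {x} \<noteq> 0}"
    by (auto simp: measure_def)
qed

text \<open>With \<open>x\<close> removed, the shrinking neighbourhoods decrease to the empty set,
  and continuity from above applies because their mass inside the compact interval is
  finite.\<close>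

lemma finite_on_small_punctured:
  assumes M: "finite_on \<alpha> \<beta> M" and x: "x \<in> {\<alpha>..\<beta>}" and e: "e > 0"
  shows "\<exists>d>0. measure M (({x-d<..<x+d} - {x}) \<inter> {\<alpha>..\<beta>}) < e"
proof -
  let ?A = "\<lambda>n. ({x - 1 / real (Suc n)<..<x + 1 / real (Suc n)} - {x}) \<inter> {\<alpha>..\<beta>}"
  have "(\<lambda>n. measure M (?A n)) \<longlonglongrightarrow> measure M (\<Inter>n. ?A n)"
  proof (rule Lim_measure_decseq)
    show "range ?A \<subseteq> sets M" by (auto simp: finite_on_sets[OF M])
    show "decseq ?A"
      unfolding decseq_def
    proof (intro allI impI)
      fix m n :: nat assume "m \<le> n"
      then have "1 / real (Suc n) \<le> 1 / real (Suc m)" by (simp add: frac_le)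
      then show "?A n \<subseteq> ?A m" by auto
    qed
    show "emeasure M (?A i) \<noteq> \<infinity>" for i
      using finite_on_subset[OF M, of "?A i"] by auto
  qed
  moreover have "(\<Inter>n. ?A n) = {}"
  proof -
    have False if "\<And>n. t \<in> ?A n" for t
    proof -
      from that[of 0] have "\<bar>t - x\<bar> > 0" by auto
      then obtain n where "inverse (real (Suc n)) < \<bar>t - x\<bar>" using reals_Archimedean by blast
      then show False using that[of n] by (auto simp: inverse_eq_divide abs_if split: if_splits)
    qed
    then show ?thesis by blast
  qed
  ultimately have "(\<lambda>n. measure M (?A n)) \<longlonglongrightarrow> 0" by simp
  then have "eventually (\<lambda>n. measure M (?A n) < e) sequentially"
    using e by (rule order_tendstoD)
  then obtain n where "measure M (?A n) < e"
    by (auto simp: eventually_sequentially)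
  then show ?thesis by (intro exI[of _ "1 / real (Suc n)"]) auto
qed

text \<open>The extra quantifier over \<open>d' \<le> d\<close> makes the statement stable under
  taking the minimum of the radii of several measures.\<close>

lemma finite_on_small:
  assumes M: "finite_on \<alpha> \<beta> M" and x: "x \<in> {\<alpha>..\<beta>}" and e: "e > 0"
  shows "\<exists>d>0. \<forall>d'\<le>d. \<forall>t.
     (x < t \<and> t < x + d' \<and> t \<le> \<beta> \<longrightarrow> measure M {x<..<t} \<le> e) \<and>
     (x - d' < t \<and> t < x \<and> \<alpha> \<le> t \<longrightarrow> measure M {t<..<x} \<le> e)"
proof -
  obtain d where d: "d > 0" "measure M (({x-d<..<x+d} - {x}) \<inter> {\<alpha>..\<beta>}) < e"
    using finite_on_small_punctured[OF assms] by blast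
  have "measure M {s<..<t} \<le> e"
    if "{s<..<t} \<subseteq> ({x-d<..<x+d} - {x}) \<inter> {\<alpha>..\<beta>}" for s t
    using finite_on_measure_mono[OF M _ _ that] d(2) by auto
  moreover have "{x<..<t} \<subseteq> ({x-d<..<x+d} - {x}) \<inter> {\<alpha>..\<beta>}" if "t < x + d" "t \<le> \<beta>" for t
    using that x by auto
  moreover have "{t<..<x} \<subseteq> ({x-d<..<x+d} - {x}) \<inter> {\<alpha>..\<beta>}" if "x - d < t" "\<alpha> \<le> t" for t
    using that x by auto
  ultimately show ?thesis using d(1) by (intro exI[of _ d]) auto
qed

text \<open>The set function fed into the Gronwall inequality. Adding the numbers avoids forming a
  sum measure, and \<open>r\<close> alone carries the dependence on the spectral parameter.\<close>

definition weighted_measure :: "real \<Rightarrow> 'i set \<Rightarrow> ('i \<Rightarrow> real measure) \<Rightarrow> real set \<Rightarrow> real" where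
  "weighted_measure r J M A = r * (\<Sum>i\<in>J. measure (M i) A)"

lemma weighted_measure_nonneg: "0 \<le> r \<Longrightarrow> 0 \<le> weighted_measure r J M A"
  by (simp add: weighted_measure_def sum_nonneg)

lemma weighted_measure_Un:
  assumes "\<And>i. i \<in> J \<Longrightarrow> finite_on \<alpha> \<beta> (M i)"
    and "A \<in> sets borel" "B \<in> sets borel" "A \<inter> B = {}" "A \<union> B \<subseteq> {\<alpha>..\<beta>}"
  shows "weighted_measure r J M (A \<union> B) = weighted_measure r J M A + weighted_measure r J M B"
proof -
  have "(\<Sum>i\<in>J. measure (M i) (A \<union> B)) = (\<Sum>i\<in>J. measure (M i) A + measure (M i) B)"
    using assms by (intro sum.cong finite_on_measure_Un) auto
  then show ?thesis by (simp add: weighted_measure_def sum.distrib distrib_left)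
qed

lemma weighted_measure_mono:
  assumes "\<And>i. i \<in> J \<Longrightarrow> finite_on \<alpha> \<beta> (M i)" "0 \<le> r"
    and "A \<in> sets borel" "B \<in> sets borel" "A \<subseteq> B" "B \<subseteq> {\<alpha>..\<beta>}"
  shows "weighted_measure r J M A \<le> weighted_measure r J M B"
  unfolding weighted_measure_def
  using assms by (intro mult_left_mono sum_mono finite_on_measure_mono) auto

lemma weighted_measure_small:
  assumes J: "finite J" and M: "\<And>i. i \<in> J \<Longrightarrow> finite_on \<alpha> \<beta> (M i)" and r: "0 \<le> r"
    and x: "x \<in> {\<alpha>..\<beta>}"
  shows "\<exists>d>0. \<forall>t.
     (x < t \<and> t < x + d \<and> t \<le> \<beta> \<longrightarrow> weighted_measure r J M {x<..<t} \<le> 1/2) \<and>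
     (x - d < t \<and> t < x \<and> \<alpha> \<le> t \<longrightarrow> weighted_measure r J M {t<..<x} \<le> 1/2)"
proof -
  \<comment> \<open>Chosen so that \<open>r * card J * e \<le> r / (2 * (r + 1)) \<le> 1/2\<close>;
    the added ones keep the denominator positive when \<open>r = 0\<close> or \<open>J\<close> is
    empty.\<close>
  define e where "e = 1 / (2 * (r + 1) * (real (card J) + 1))"
  have e: "e > 0" unfolding e_def using r by simp
  let ?Q = "\<lambda>i d. \<forall>t. (x < t \<and> t < x + d \<and> t \<le> \<beta> \<longrightarrow> measure (M i) {x<..<t} \<le> e) \<and>
     (x - d < t \<and> t < x \<and> \<alpha> \<le> t \<longrightarrow> measure (M i) {t<..<x} \<le> e)"
  have "\<exists>d>0. \<forall>i\<in>J. \<forall>d'\<le>d. ?Q i d'"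
    using J M
  proof (induction J)
    case empty
    show ?case by (intro exI[of _ 1]) auto
  next
    case (insert j J)
    obtain d where d: "d > 0" "\<forall>i\<in>J. \<forall>d'\<le>d. ?Q i d'"
      using insert.IH insert.prems by (metis insertCI)
    obtain d1 where d1: "d1 > 0" "\<forall>d'\<le>d1. ?Q j d'"
      using finite_on_small[OF insert.prems[of j] x e] by blast
    show ?case
    proof (intro exI[of _ "min d d1"] conjI ballI)
      show "\<forall>d'\<le>min d d1. ?Q i d'" if "i \<in> insert j J" for i
        using that d(2) d1(2) by (metis insertE min.boundedE)
    qed (use d d1 in auto)
  qed
  then obtain d where d: "d > 0" "\<And>i. i \<in> J \<Longrightarrow> ?Q i d" by blast
  have bound: "weighted_measure r J M A \<le> 1/2" if "\<And>i. i \<in> J \<Longrightarrow> measure (M i) A \<le> e" for A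
  proof -
    have "(\<Sum>i\<in>J. measure (M i) A) \<le> real (card J) * e"
      using that by (rule sum_bounded_above)
    also have "\<dots> \<le> (real (card J) + 1) * e" using e by (simp add: mult_right_mono)
    also have "\<dots> = 1 / (2 * (r + 1))" unfolding e_def by simp
    finally have "weighted_measure r J M A \<le> r * (1 / (2 * (r + 1)))"
      unfolding weighted_measure_def using r by (intro mult_left_mono) auto
    also have "\<dots> \<le> 1/2" using r by (simp add: field_simps)
    finally show ?thesis .
  qed
  show ?thesis
  proof (intro exI[of _ d] conjI allI impI d(1))
    fix t
    show "weighted_measure r J M {x<..<t} \<le> 1/2" if "x < t \<and> t < x + d \<and> t \<le> \<beta>"
      using d(2) that by (intro bound) blast
    show "weighted_measure r J M {t<..<x} \<le> 1/2" if "x - d < t \<and> t < x \<and> \<alpha> \<le> t"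
      using d(2) that by (intro bound) blast
  qed
qed

section \<open>Integral form of the Gronwall inequality for several measures\<close>

lemma set_integral_mono_domain:
  fixes U :: "real \<Rightarrow> real"
  assumes M: "finite_on \<alpha> \<beta> M" and U: "set_integrable M {\<alpha>..\<beta>} U"
    and U0: "\<And>t. t \<in> {\<alpha>..\<beta>} \<Longrightarrow> 0 \<le> U t"
    and "T \<in> sets borel" "T' \<in> sets borel" "T \<subseteq> T'" "T' \<subseteq> {\<alpha>..\<beta>}"
  shows "(LINT t:T|M. U t) \<le> (LINT t:T'|M. U t)"
proof -
  have "set_integrable M T U" "set_integrable M T' U"
    using assms by (auto intro!: set_integrable_subset[OF U] simp: finite_on_sets[OF M])
  then show ?thesis
    unfolding set_lebesgue_integral_def set_integrable_def
  proof (rule integral_mono)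
    show "indicator T t *\<^sub>R U t \<le> indicator T' t *\<^sub>R U t" for t
      using U0[of t] assms(6,7) by (auto simp: indicator_def)
  qed
qed

text \<open>Only a covering of \<open>T'\<close> is required, so the same lemma serves intervals
  growing to the right and to the left. The bound at \<open>s\<close> is asked almost everywhere: it
  is a true bound if \<open>s\<close> is an atom, and otherwise its term has weight zero.\<close>

lemma set_integral_increment:
  fixes U :: "real \<Rightarrow> real"
  assumes M: "finite_on \<alpha> \<beta> M" and U: "set_integrable M {\<alpha>..\<beta>} U"
    and U0: "\<And>t. t \<in> {\<alpha>..\<beta>} \<Longrightarrow> 0 \<le> U t"
    and T: "T \<in> sets borel" "T' \<in> sets borel" "G \<in> sets borel"
      "T \<subseteq> {\<alpha>..\<beta>}" "T' \<subseteq> {\<alpha>..\<beta>}" "G \<subseteq> {\<alpha>..\<beta>}" "s \<in> {\<alpha>..\<beta>}" "T' \<subseteq> T \<union> {s} \<union> G"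
    and a: "0 \<le> a" "AE t in M. t = s \<longrightarrow> U t \<le> a"
    and b: "0 \<le> b" "AE t in M. t \<in> G \<longrightarrow> U t \<le> b"
  shows "(LINT t:T'|M. U t) \<le> (LINT t:T|M. U t) + measure M {s} * a + measure M G * b"
proof -
  have i: "set_integrable M T U" "set_integrable M T' U"
    using T by (auto intro!: set_integrable_subset[OF U] simp: finite_on_sets[OF M])
  have fin: "emeasure M G < \<infinity>" "emeasure M {s} < \<infinity>"
    using T finite_on_subset[OF M, of G] finite_on_subset[OF M, of "{s}"] by auto
  have j: "integrable M (\<lambda>t. indicator G t * b)" "integrable M (\<lambda>t. indicator {s} t * a)"
    using T fin by (auto intro!: integrable_mult_left integrable_real_indicator simp: finite_on_sets[OF M])
  have "(LINT t|M. indicator T' t *\<^sub>R U t)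
      \<le> (LINT t|M. indicator T t *\<^sub>R U t + indicator {s} t * a + indicator G t * b)"
  proof (rule integral_mono_AE)
    show "AE t in M. indicator T' t *\<^sub>R U t
        \<le> indicator T t *\<^sub>R U t + indicator {s} t * a + indicator G t * b"
      using a(2) b(2)
    proof eventually_elim
      case (elim t)
      show ?case
      proof (cases "t \<in> T'")
        case True
        then have "0 \<le> U t" "t \<in> T \<or> t = s \<or> t \<in> G" using U0 T by auto
        then show ?thesis using elim True a(1) b(1) by (auto simp: indicator_def)
      next
        case False
        have "0 \<le> indicator T t *\<^sub>R U t" using U0[of t] T by (auto simp: indicator_def)
        then show ?thesis using False a(1) b(1) by (simp add: indicator_def)
      qed
    qed
  qed (use i j in \<open>auto simp: set_integrable_def\<close>)
  also have "\<dots> = (LINT t|M. indicator T t *\<^sub>R U t) + (LINT t|M. indicator {s} t * a)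
      + (LINT t|M. indicator G t * b)"
    using i j by (simp add: set_integrable_def)
  also have "\<dots> = (LINT t|M. indicator T t *\<^sub>R U t) + measure M {s} * a + measure M G * b"
    using T by (simp add: finite_on_sets[OF M] finite_on_space[OF M])
  finally show ?thesis by (simp add: set_lebesgue_integral_def)
qed

lemma sum_set_integral_increment:
  fixes U :: "'i \<Rightarrow> real \<Rightarrow> real" and y :: "real \<Rightarrow> real"
  assumes M: "\<And>i. i \<in> J \<Longrightarrow> finite_on \<alpha> \<beta> (M i)"
    and U: "\<And>i. i \<in> J \<Longrightarrow> set_integrable (M i) {\<alpha>..\<beta>} (U i)"
    and U0: "\<And>i t. i \<in> J \<Longrightarrow> t \<in> {\<alpha>..\<beta>} \<Longrightarrow> 0 \<le> U i t"
    and Uy: "\<And>i. i \<in> J \<Longrightarrow> AE t in M i. t \<in> {\<alpha>..\<beta>} \<longrightarrow> U i t \<le> y t"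
    and r: "0 \<le> r"
    and T: "T \<in> sets borel" "T' \<in> sets borel" "G \<in> sets borel"
      "T \<subseteq> {\<alpha>..\<beta>}" "T' \<subseteq> {\<alpha>..\<beta>}" "G \<subseteq> {\<alpha>..\<beta>}" "s \<in> {\<alpha>..\<beta>}" "T' \<subseteq> T \<union> {s} \<union> G"
    and a: "0 \<le> a" "y s \<le> a" and b: "0 \<le> b" "\<And>t. t \<in> G \<Longrightarrow> y t \<le> b"
  shows "r * (\<Sum>i\<in>J. LINT t:T'|M i. U i t) \<le> r * (\<Sum>i\<in>J. LINT t:T|M i. U i t)
    + weighted_measure r J M {s} * a + weighted_measure r J M G * b"
proof -
  have "(\<Sum>i\<in>J. LINT t:T'|M i. U i t)
      \<le> (\<Sum>i\<in>J. (LINT t:T|M i. U i t) + measure (M i) {s} * a + measure (M i) G * b)"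
  proof (rule sum_mono)
    fix i assume i: "i \<in> J"
    show "(LINT t:T'|M i. U i t) \<le> (LINT t:T|M i. U i t) + measure (M i) {s} * a + measure (M i) G * b"
    proof (rule set_integral_increment[OF M[OF i] U[OF i] U0[OF i] T a(1) _ b(1)])
      show "AE t in M i. t = s \<longrightarrow> U i t \<le> a"
        using Uy[OF i] by eventually_elim (use a T in auto)
      show "AE t in M i. t \<in> G \<longrightarrow> U i t \<le> b"
        using Uy[OF i] by eventually_elim (use b T in fastforce)
    qed
  qed
  from mult_left_mono[OF this r] show ?thesis
    by (simp add: weighted_measure_def sum.distrib sum_distrib_right[symmetric] distrib_left mult.assoc)
qed

text \<open>Domination by \<open>y\<close> is only asked almost everywhere: below, \<open>y\<close> is built from right limits,
  which differ from the \<open>U i\<close> at atoms.\<close>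

lemma integral_gronwall_right:
  fixes U :: "'i \<Rightarrow> real \<Rightarrow> real" and y :: "real \<Rightarrow> real"
  assumes J: "finite J" and M: "\<And>i. i \<in> J \<Longrightarrow> finite_on \<alpha> \<beta> (M i)"
    and U: "\<And>i. i \<in> J \<Longrightarrow> set_integrable (M i) {\<alpha>..\<beta>} (U i)"
    and U0: "\<And>i t. i \<in> J \<Longrightarrow> t \<in> {\<alpha>..\<beta>} \<Longrightarrow> 0 \<le> U i t"
    and Uy: "\<And>i. i \<in> J \<Longrightarrow> AE t in M i. t \<in> {\<alpha>..\<beta>} \<longrightarrow> U i t \<le> y t"
    and r: "0 \<le> r" and A: "0 \<le> A"
    and y: "\<And>x. c \<le> x \<Longrightarrow> x \<le> \<beta> \<Longrightarrow> y x \<le> A + r * (\<Sum>i\<in>J. LINT t:{c..<x}|M i. U i t)"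
    and x: "\<alpha> \<le> c" "c \<le> x" "x \<le> \<beta>"
  shows "y x \<le> A * exp (2 * weighted_measure r J M {\<alpha>..\<beta>})"
proof -
  \<comment> \<open>The right-hand side replaces \<open>y\<close>: it is nondecreasing, which
    \<open>y\<close> need not be, so all values of \<open>y\<close> on an open interval
    \<open>(s,t)\<close> are at most \<open>E t\<close>.\<close>
  define E where "E x = A + r * (\<Sum>i\<in>J. LINT t:{c..<x}|M i. U i t)" for x
  let ?m = "weighted_measure r J M"
  have mono: "E s \<le> E t" if "s \<le> t" "t \<le> \<beta>" for s t
    unfolding E_def using that x r
    by (intro add_left_mono mult_left_mono sum_mono set_integral_mono_domain[OF M U U0]) auto
  have E0: "0 \<le> E t" if "c \<le> t" "t \<le> \<beta>" for t
    using mono[of c t] that A by (simp add: E_def set_lebesgue_integral_def)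
  have "E x \<le> E c * exp (2 * ?m {c..<x})"
  proof (rule gronwall_forward)
    fix s t assume st: "c \<le> s" "s < t" "t \<le> x"
    then have *: "{s..<t} = {s} \<union> {s<..<t}" by auto
    show "?m {s..<t} = ?m {s} + ?m {s<..<t}"
      unfolding * by (rule weighted_measure_Un[OF M]) (use st x in auto)
    have "r * (\<Sum>i\<in>J. LINT t:{c..<t}|M i. U i t) \<le> r * (\<Sum>i\<in>J. LINT t:{c..<s}|M i. U i t)
        + ?m {s} * E s + ?m {s<..<t} * E t"
    proof (rule sum_set_integral_increment[OF M U U0 Uy r])
      show "y s \<le> E s" using y st x by (simp add: E_def)
      show "y t' \<le> E t" if "t' \<in> {s<..<t}" for t'
        using y[of t'] mono[of t' t] that st x by (simp add: E_def)
    qed (use st x E0 in auto)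
    then show "E t \<le> E s + ?m {s} * E s + ?m {s<..<t} * E t" by (simp add: E_def)
  next
    fix s t u assume "c \<le> s" "s \<le> t" "t \<le> u" "u \<le> x"
    note stu = this
    then have *: "{s..<u} = {s..<t} \<union> {t..<u}" by auto
    show "?m {s..<u} = ?m {s..<t} + ?m {t..<u}"
      unfolding * by (rule weighted_measure_Un[OF M]) (use stu x in auto)
  next
    fix t assume t: "c \<le> t" "t \<le> x"
    then have "t \<in> {\<alpha>..\<beta>}" using x by auto
    from weighted_measure_small[where M = M, OF J M r this]
    obtain d where d: "d > 0" "\<forall>s. (t < s \<and> s < t + d \<and> s \<le> \<beta> \<longrightarrow> ?m {t<..<s} \<le> 1/2) \<and>
        (t - d < s \<and> s < t \<and> \<alpha> \<le> s \<longrightarrow> ?m {s<..<t} \<le> 1/2)" by blast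
    then show "\<exists>d>0. \<forall>s. (t < s \<and> s < t + d \<and> s \<le> x \<longrightarrow> ?m {t<..<s} \<le> 1/2) \<and>
        (t - d < s \<and> s < t \<and> c \<le> s \<longrightarrow> ?m {s<..<t} \<le> 1/2)"
      using x by (intro exI[of _ d]) force
  qed (use x E0 weighted_measure_nonneg[OF r] in auto)
  also have "E c = A" by (simp add: E_def set_lebesgue_integral_def)
  also have "A * exp (2 * ?m {c..<x}) \<le> A * exp (2 * ?m {\<alpha>..\<beta>})"
  proof -
    have "?m {c..<x} \<le> ?m {\<alpha>..\<beta>}"
      using x by (intro weighted_measure_mono[OF M r]) auto
    then show ?thesis using A by (intro mult_left_mono) auto
  qed
  finally show ?thesis using y[of x] x by (simp add: E_def)
qed

text \<open>The domain \<open>(x,c)\<close> leaves out \<open>x\<close>, so \<open>y x\<close> is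
  controlled by values strictly to its right. Extending from \<open>t\<close> down to
  \<open>s\<close> adds the point \<open>t\<close>, whose atom is charged to the already known
  \<open>E t\<close>.\<close>

lemma integral_gronwall_left:
  fixes U :: "'i \<Rightarrow> real \<Rightarrow> real" and y :: "real \<Rightarrow> real"
  assumes J: "finite J" and M: "\<And>i. i \<in> J \<Longrightarrow> finite_on \<alpha> \<beta> (M i)"
    and U: "\<And>i. i \<in> J \<Longrightarrow> set_integrable (M i) {\<alpha>..\<beta>} (U i)"
    and U0: "\<And>i t. i \<in> J \<Longrightarrow> t \<in> {\<alpha>..\<beta>} \<Longrightarrow> 0 \<le> U i t"
    and Uy: "\<And>i. i \<in> J \<Longrightarrow> AE t in M i. t \<in> {\<alpha>..\<beta>} \<longrightarrow> U i t \<le> y t"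
    and r: "0 \<le> r" and A: "0 \<le> A"
    and y: "\<And>x. \<alpha> \<le> x \<Longrightarrow> x \<le> c \<Longrightarrow> y x \<le> A + r * (\<Sum>i\<in>J. LINT t:{x<..<c}|M i. U i t)"
    and x: "\<alpha> \<le> x" "x \<le> c" "c \<le> \<beta>"
  shows "y x \<le> A * exp (2 * weighted_measure r J M {\<alpha>..\<beta>})"
proof -
  define E where "E x = A + r * (\<Sum>i\<in>J. LINT t:{x<..<c}|M i. U i t)" for x
  let ?m = "weighted_measure r J M"
  have mono: "E t \<le> E s" if "s \<le> t" "\<alpha> \<le> s" for s t
    unfolding E_def using that x r
    by (intro add_left_mono mult_left_mono sum_mono set_integral_mono_domain[OF M U U0]) auto
  have E0: "0 \<le> E t" if "\<alpha> \<le> t" "t \<le> c" for t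
    using mono[of t c] that A by (simp add: E_def set_lebesgue_integral_def)
  have "E x \<le> E c * exp (2 * ?m {x<..c})"
  proof (rule gronwall_backward)
    fix s t assume st: "x \<le> s" "s < t" "t \<le> c"
    then have *: "{s<..t} = {t} \<union> {s<..<t}" by auto
    show "?m {s<..t} = ?m {t} + ?m {s<..<t}"
      unfolding * by (rule weighted_measure_Un[OF M]) (use st x in auto)
    have "r * (\<Sum>i\<in>J. LINT t:{s<..<c}|M i. U i t) \<le> r * (\<Sum>i\<in>J. LINT t:{t<..<c}|M i. U i t)
        + ?m {t} * E t + ?m {s<..<t} * E s"
    proof (rule sum_set_integral_increment[OF M U U0 Uy r])
      show "y t \<le> E t" using y st x by (simp add: E_def)
      show "y t' \<le> E s" if "t' \<in> {s<..<t}" for t'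
        using y[of t'] mono[of s t'] that st x by (simp add: E_def)
    qed (use st x E0 in auto)
    then show "E s \<le> E t + ?m {t} * E t + ?m {s<..<t} * E s" by (simp add: E_def)
  next
    fix s t u assume "x \<le> s" "s \<le> t" "t \<le> u" "u \<le> c"
    note stu = this
    then have *: "{s<..u} = {s<..t} \<union> {t<..u}" by auto
    show "?m {s<..u} = ?m {s<..t} + ?m {t<..u}"
      unfolding * by (rule weighted_measure_Un[OF M]) (use stu x in auto)
  next
    fix t assume t: "x \<le> t" "t \<le> c"
    then have "t \<in> {\<alpha>..\<beta>}" using x by auto
    from weighted_measure_small[where M = M, OF J M r this]
    obtain d where d: "d > 0" "\<forall>s. (t < s \<and> s < t + d \<and> s \<le> \<beta> \<longrightarrow> ?m {t<..<s} \<le> 1/2) \<and>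
        (t - d < s \<and> s < t \<and> \<alpha> \<le> s \<longrightarrow> ?m {s<..<t} \<le> 1/2)" by blast
    then show "\<exists>d>0. \<forall>s. (t < s \<and> s < t + d \<and> s \<le> c \<longrightarrow> ?m {t<..<s} \<le> 1/2) \<and>
        (t - d < s \<and> s < t \<and> x \<le> s \<longrightarrow> ?m {s<..<t} \<le> 1/2)"
      using x by (intro exI[of _ d]) force
  qed (use x E0 weighted_measure_nonneg[OF r] in auto)
  also have "E c = A" by (simp add: E_def set_lebesgue_integral_def)
  also have "A * exp (2 * ?m {x<..c}) \<le> A * exp (2 * ?m {\<alpha>..\<beta>})"
  proof -
    have "?m {x<..c} \<le> ?m {\<alpha>..\<beta>}"
      using x by (intro weighted_measure_mono[OF M r]) auto
    then show ?thesis using A by (intro mult_left_mono) auto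
  qed
  finally show ?thesis using y[of x] x by (simp add: E_def)
qed

section \<open>Integration against complex measures\<close>

definition cm_on :: "real \<Rightarrow> real \<Rightarrow> cmeasure \<Rightarrow> bool" where
  "cm_on \<alpha> \<beta> \<mu> \<longleftrightarrow> finite_on \<alpha> \<beta> (fst \<mu>) \<and> snd \<mu> \<in> borel_measurable borel \<and>
     (AE t in fst \<mu>. norm (snd \<mu> t) = 1)"

lemma ointerval_subset:
  assumes "\<alpha> \<in> ointerval a b" "\<beta> \<in> ointerval a b"
  shows "{\<alpha>..\<beta>} \<subseteq> ointerval a b"
proof
  fix x assume "x \<in> {\<alpha>..\<beta>}"
  moreover have "a < ereal \<alpha>" "ereal \<beta> < b" using assms by (auto simp: ointerval_def)
  ultimately show "x \<in> ointerval a b"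
    unfolding ointerval_def
    by (auto intro: less_le_trans[of a "ereal \<alpha>" "ereal x"] le_less_trans[of "ereal x" "ereal \<beta>" b])
qed

lemma loc_fin_cmeasure_imp_cm_on:
  assumes "loc_fin_cmeasure (ointerval a b) \<mu>" "\<alpha> \<in> ointerval a b" "\<beta> \<in> ointerval a b"
  shows "cm_on \<alpha> \<beta> \<mu>"
  using assms ointerval_subset[OF assms(2,3)] compact_Icc[of \<alpha> \<beta>]
  by (simp add: loc_fin_cmeasure_def cm_on_def finite_on_def)

text \<open>Solutions are constrained only on the interval \<open>I\<close>, hence measurability is
  asked of the restriction. Boundedness makes a function integrable for all three measures at
  once.\<close>

definition bounded_borel_on :: "real \<Rightarrow> real \<Rightarrow> (real \<Rightarrow> complex) \<Rightarrow> bool" where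
  "bounded_borel_on \<alpha> \<beta> u \<longleftrightarrow>
     set_borel_measurable borel {\<alpha>..\<beta>} u \<and> (\<exists>B. \<forall>x\<in>{\<alpha>..\<beta>}. norm (u x) \<le> B)"

lemma bounded_borel_on_add:
  assumes "bounded_borel_on \<alpha> \<beta> u" "bounded_borel_on \<alpha> \<beta> v"
  shows "bounded_borel_on \<alpha> \<beta> (\<lambda>x. u x + v x)"
proof -
  obtain B B' where "\<forall>x\<in>{\<alpha>..\<beta>}. norm (u x) \<le> B" "\<forall>x\<in>{\<alpha>..\<beta>}. norm (v x) \<le> B'"
    using assms by (auto simp: bounded_borel_on_def)
  then have "\<forall>x\<in>{\<alpha>..\<beta>}. norm (u x + v x) \<le> B + B'"
    by (meson add_mono norm_triangle_ineq order_trans)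
  then show ?thesis
    using assms by (auto simp: bounded_borel_on_def set_borel_measurable_def scaleR_add_right)
qed

lemma bounded_borel_on_mult:
  assumes "bounded_borel_on \<alpha> \<beta> u"
  shows "bounded_borel_on \<alpha> \<beta> (\<lambda>x. k * u x)"
proof -
  obtain B where "\<forall>x\<in>{\<alpha>..\<beta>}. norm (u x) \<le> B"
    using assms by (auto simp: bounded_borel_on_def)
  then have "\<forall>x\<in>{\<alpha>..\<beta>}. norm (k * u x) \<le> norm k * B"
    by (simp add: norm_mult mult_left_mono)
  moreover have "set_borel_measurable borel {\<alpha>..\<beta>} (\<lambda>x. k * u x)"
    using assms borel_measurable_times[of "\<lambda>x. k" borel "\<lambda>x. indicator {\<alpha>..\<beta>} x *\<^sub>R u x"]
    by (simp add: bounded_borel_on_def set_borel_measurable_def)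
  ultimately show ?thesis by (auto simp: bounded_borel_on_def)
qed

lemma bounded_borel_on_const: "bounded_borel_on \<alpha> \<beta> (\<lambda>x. k)"
  by (auto simp: bounded_borel_on_def set_borel_measurable_def)

lemma bounded_borel_on_diff:
  assumes "bounded_borel_on \<alpha> \<beta> u" "bounded_borel_on \<alpha> \<beta> v"
  shows "bounded_borel_on \<alpha> \<beta> (\<lambda>x. u x - v x)"
  using bounded_borel_on_add[OF assms(1) bounded_borel_on_mult[OF assms(2), of "-1"]] by simp

lemma bounded_borel_on_cong:
  assumes "bounded_borel_on \<alpha> \<beta> u" "\<And>x. x \<in> {\<alpha>..\<beta>} \<Longrightarrow> v x = u x"
  shows "bounded_borel_on \<alpha> \<beta> v"
proof -
  have "(\<lambda>x. indicator {\<alpha>..\<beta>} x *\<^sub>R v x) = (\<lambda>x. indicator {\<alpha>..\<beta>} x *\<^sub>R u x)"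
    using assms(2) by (intro ext) (auto split: split_indicator)
  then show ?thesis using assms by (simp add: bounded_borel_on_def set_borel_measurable_def)
qed

lemma bounded_borel_on_set_integrable:
  assumes M: "finite_on \<alpha> \<beta> M" and u: "bounded_borel_on \<alpha> \<beta> u"
  shows "set_integrable M {\<alpha>..\<beta>} u"
proof -
  obtain B where "\<forall>x\<in>{\<alpha>..\<beta>}. norm (u x) \<le> B"
    using u by (auto simp: bounded_borel_on_def)
  then show ?thesis
    using M u unfolding set_integrable_def
    by (intro integrableI_bounded_set[of "{\<alpha>..\<beta>}" _ _ B])
       (auto simp: finite_on_def finite_on_measurable[OF M] bounded_borel_on_def set_borel_measurable_def)
qed

lemma cm_on_measurable: "cm_on \<alpha> \<beta> \<mu> \<Longrightarrow> snd \<mu> \<in> borel_measurable (fst \<mu>)"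
  by (auto simp: cm_on_def finite_on_measurable)

lemma cm_on_set_integrable:
  assumes \<mu>: "cm_on \<alpha> \<beta> \<mu>" and h: "set_integrable (fst \<mu>) {\<alpha>..\<beta>} h"
    and A: "A \<in> sets borel" "A \<subseteq> {\<alpha>..\<beta>}"
  shows "set_integrable (fst \<mu>) A (\<lambda>t. h t * snd \<mu> t)"
proof -
  have M: "finite_on \<alpha> \<beta> (fst \<mu>)" using \<mu> by (simp add: cm_on_def)
  have i: "integrable (fst \<mu>) (\<lambda>t. indicator A t *\<^sub>R h t)"
    using set_integrable_subset[OF h] A by (simp add: finite_on_sets[OF M] set_integrable_def)
  then have "integrable (fst \<mu>) (\<lambda>t. (indicator A t *\<^sub>R h t) * snd \<mu> t)"
  proof (rule Bochner_Integration.integrable_bound)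
    show "AE t in fst \<mu>. norm ((indicator A t *\<^sub>R h t) * snd \<mu> t) \<le> norm (indicator A t *\<^sub>R h t)"
      using \<mu> unfolding cm_on_def by (auto simp: norm_mult)
    show "(\<lambda>t. (indicator A t *\<^sub>R h t) * snd \<mu> t) \<in> borel_measurable (fst \<mu>)"
      using borel_measurable_integrable[OF i] cm_on_measurable[OF \<mu>] by (rule borel_measurable_times)
  qed
  then show ?thesis by (simp add: set_integrable_def)
qed

lemma cm_on_norm_integral_le:
  assumes \<mu>: "cm_on \<alpha> \<beta> \<mu>" and h: "set_integrable (fst \<mu>) {\<alpha>..\<beta>} h"
    and A: "A \<in> sets borel" "A \<subseteq> {\<alpha>..\<beta>}"
  shows "norm (LINT t:A|fst \<mu>. h t * snd \<mu> t) \<le> (LINT t:A|fst \<mu>. norm (h t))"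
proof -
  have M: "finite_on \<alpha> \<beta> (fst \<mu>)" using \<mu> by (simp add: cm_on_def)
  have "integrable (fst \<mu>) (\<lambda>t. indicator A t *\<^sub>R h t)"
    using set_integrable_subset[OF h] A by (simp add: finite_on_sets[OF M] set_integrable_def)
  from integrable_norm[OF this] have i: "integrable (fst \<mu>) (\<lambda>t. indicator A t *\<^sub>R norm (h t))"
    by simp
  have j: "integrable (fst \<mu>) (\<lambda>t. indicator A t *\<^sub>R (h t * snd \<mu> t))"
    using cm_on_set_integrable[OF assms] by (simp add: set_integrable_def)
  have "norm (LINT t:A|fst \<mu>. h t * snd \<mu> t) \<le> (LINT t|fst \<mu>. norm (indicator A t *\<^sub>R (h t * snd \<mu> t)))"
    unfolding set_lebesgue_integral_def by (rule integral_norm_bound)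
  also have "\<dots> \<le> (LINT t|fst \<mu>. indicator A t *\<^sub>R norm (h t))"
  proof (rule integral_mono_AE[OF integrable_norm[OF j] i])
    show "AE t in fst \<mu>. norm (indicator A t *\<^sub>R (h t * snd \<mu> t)) \<le> indicator A t *\<^sub>R norm (h t)"
      using \<mu> unfolding cm_on_def by (auto simp: norm_mult)
  qed
  finally show ?thesis by (simp add: set_lebesgue_integral_def)
qed

section \<open>The oriented integral \<open>cint\<close>\<close>

lemma cint_eq:
  "cint \<mu> c x h = (if c \<le> x then LINT t:{c..<x}|fst \<mu>. h t * snd \<mu> t
     else - (LINT t:{x..<c}|fst \<mu>. h t * snd \<mu> t))"
  by (auto simp: cint_def set_lebesgue_integral_def)

lemma cint_base [simp]: "cint \<mu> c c h = 0"
  by (simp add: cint_def)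

text \<open>The set and the sign depend on \<open>c\<close> and \<open>x\<close> alone, not on
  measure or integrand. Norm bounds, additivity and congruence can therefore be proved for plain set
  integrals, without separating the two sides of \<open>c\<close>.\<close>

lemma cint_as_integral:
  assumes "c \<in> {\<alpha>..\<beta>}" "x \<in> {\<alpha>..\<beta>}"
  obtains A and s :: complex where "A \<in> sets borel" "A \<subseteq> {\<alpha>..\<beta>}" "norm s = 1"
    "\<And>\<mu> h. cint \<mu> c x h = s * (LINT t:A|fst \<mu>. h t * snd \<mu> t)"
proof (cases "c \<le> x")
  case True
  then show ?thesis by (intro that[of "{c..<x}" 1]) (use assms in \<open>auto simp: cint_eq\<close>)
next
  case False
  then show ?thesis by (intro that[of "{x..<c}" "-1"]) (use assms in \<open>auto simp: cint_eq\<close>)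
qed

lemma norm_cint_le:
  assumes \<mu>: "cm_on \<alpha> \<beta> \<mu>" and h: "set_integrable (fst \<mu>) {\<alpha>..\<beta>} h"
    and c: "c \<in> {\<alpha>..\<beta>}" and x: "x \<in> {\<alpha>..\<beta>}"
  shows "norm (cint \<mu> c x h) \<le> (LINT t:{\<alpha>..\<beta>}|fst \<mu>. norm (h t))"
proof -
  have M: "finite_on \<alpha> \<beta> (fst \<mu>)" using \<mu> by (simp add: cm_on_def)
  have n: "set_integrable (fst \<mu>) {\<alpha>..\<beta>} (\<lambda>t. norm (h t))"
    using integrable_norm[OF h[unfolded set_integrable_def]] by (simp add: set_integrable_def)
  have "norm (LINT t:A|fst \<mu>. h t * snd \<mu> t) \<le> (LINT t:{\<alpha>..\<beta>}|fst \<mu>. norm (h t))"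
    if "A \<in> sets borel" "A \<subseteq> {\<alpha>..\<beta>}" for A
    using cm_on_norm_integral_le[OF \<mu> h that] set_integral_mono_domain[OF M n _ that(1) _ that(2)] by simp
  moreover obtain A and s :: complex where "A \<in> sets borel" "A \<subseteq> {\<alpha>..\<beta>}" "norm s = 1"
    "\<And>\<mu> h. cint \<mu> c x h = s * (LINT t:A|fst \<mu>. h t * snd \<mu> t)"
    using cint_as_integral[OF c x] by metis
  ultimately show ?thesis by (simp add: norm_mult)
qed

lemma norm_cint_le_bound:
  assumes \<mu>: "cm_on \<alpha> \<beta> \<mu>" and h: "bounded_borel_on \<alpha> \<beta> h"
    and c: "c \<in> {\<alpha>..\<beta>}" and x: "x \<in> {\<alpha>..\<beta>}" and B: "\<And>t. t \<in> {\<alpha>..\<beta>} \<Longrightarrow> norm (h t) \<le> B"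
  shows "norm (cint \<mu> c x h) \<le> B * measure (fst \<mu>) {\<alpha>..\<beta>}"
proof -
  have M: "finite_on \<alpha> \<beta> (fst \<mu>)" using \<mu> by (simp add: cm_on_def)
  have i: "set_integrable (fst \<mu>) {\<alpha>..\<beta>} h" by (rule bounded_borel_on_set_integrable[OF M h])
  note norm_cint_le[OF \<mu> i c x]
  also have "(LINT t:{\<alpha>..\<beta>}|fst \<mu>. norm (h t)) \<le> (LINT t:{\<alpha>..\<beta>}|fst \<mu>. B)"
  proof (rule set_integral_mono)
    show "set_integrable (fst \<mu>) {\<alpha>..\<beta>} (\<lambda>t. norm (h t))"
      using integrable_norm[OF i[unfolded set_integrable_def]] by (simp add: set_integrable_def)
    show "set_integrable (fst \<mu>) {\<alpha>..\<beta>} (\<lambda>t. B)"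
      using M by (auto simp: set_integrable_def finite_on_def intro!: integrable_mult_left integrable_real_indicator)
  qed (use B in auto)
  also have "\<dots> = B * measure (fst \<mu>) {\<alpha>..\<beta>}"
    by (simp add: set_lebesgue_integral_def finite_on_sets[OF M] finite_on_space[OF M])
  finally show ?thesis .
qed

lemma cint_add:
  assumes \<mu>: "cm_on \<alpha> \<beta> \<mu>" and c: "c \<in> {\<alpha>..\<beta>}" and x: "x \<in> {\<alpha>..\<beta>}"
    and "set_integrable (fst \<mu>) {\<alpha>..\<beta>} h" "set_integrable (fst \<mu>) {\<alpha>..\<beta>} k"
  shows "cint \<mu> c x (\<lambda>t. h t + k t) = cint \<mu> c x h + cint \<mu> c x k"
proof -
  have "(LINT t:A|fst \<mu>. (h t + k t) * snd \<mu> t) = (LINT t:A|fst \<mu>. h t * snd \<mu> t) + (LINT t:A|fst \<mu>. k t * snd \<mu> t)"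
    if "A \<in> sets borel" "A \<subseteq> {\<alpha>..\<beta>}" for A
    using cm_on_set_integrable[OF \<mu> assms(4) that] cm_on_set_integrable[OF \<mu> assms(5) that]
    by (simp add: distrib_right)
  moreover obtain A and s :: complex where "A \<in> sets borel" "A \<subseteq> {\<alpha>..\<beta>}" "norm s = 1"
    "\<And>\<mu> h. cint \<mu> c x h = s * (LINT t:A|fst \<mu>. h t * snd \<mu> t)"
    using cint_as_integral[OF c x] by metis
  ultimately show ?thesis by (simp add: distrib_left)
qed

lemma cint_mult: "cint \<mu> c x (\<lambda>t. k * h t) = k * cint \<mu> c x h"
  by (simp add: cint_eq mult.assoc)

lemma cint_diff:
  assumes \<mu>: "cm_on \<alpha> \<beta> \<mu>" and c: "c \<in> {\<alpha>..\<beta>}" and x: "x \<in> {\<alpha>..\<beta>}"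
    and h: "set_integrable (fst \<mu>) {\<alpha>..\<beta>} h" and k: "set_integrable (fst \<mu>) {\<alpha>..\<beta>} k"
  shows "cint \<mu> c x (\<lambda>t. h t - k t) = cint \<mu> c x h - cint \<mu> c x k"
proof -
  have "set_integrable (fst \<mu>) {\<alpha>..\<beta>} (\<lambda>t. (- 1) * k t)" using k by (intro set_integrable_mult_right)
  from cint_add[OF \<mu> c x h this] show ?thesis unfolding cint_mult by simp
qed

lemma cint_cong_AE:
  assumes \<mu>: "cm_on \<alpha> \<beta> \<mu>" and c: "c \<in> {\<alpha>..\<beta>}" and x: "x \<in> {\<alpha>..\<beta>}"
    and h: "set_integrable (fst \<mu>) {\<alpha>..\<beta>} h" and k: "set_integrable (fst \<mu>) {\<alpha>..\<beta>} k"
    and eq: "AE t in fst \<mu>. t \<in> {\<alpha>..\<beta>} \<longrightarrow> h t = k t"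
  shows "cint \<mu> c x h = cint \<mu> c x k"
proof -
  have "(LINT t:A|fst \<mu>. h t * snd \<mu> t) = (LINT t:A|fst \<mu>. k t * snd \<mu> t)"
    if A: "A \<in> sets borel" "A \<subseteq> {\<alpha>..\<beta>}" for A
    unfolding set_lebesgue_integral_def
  proof (rule integral_cong_AE)
    show "AE t in fst \<mu>. indicator A t *\<^sub>R (h t * snd \<mu> t) = indicator A t *\<^sub>R (k t * snd \<mu> t)"
      using eq by eventually_elim (use A in \<open>auto simp: indicator_def\<close>)
  qed (use cm_on_set_integrable[OF \<mu> h A] cm_on_set_integrable[OF \<mu> k A]
      in \<open>auto simp: set_integrable_def\<close>)
  moreover obtain A and s :: complex where "A \<in> sets borel" "A \<subseteq> {\<alpha>..\<beta>}" "norm s = 1"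
    "\<And>\<mu> h. cint \<mu> c x h = s * (LINT t:A|fst \<mu>. h t * snd \<mu> t)"
    using cint_as_integral[OF c x] by metis
  ultimately show ?thesis by simp
qed

text \<open>Measurability in the limit of integration: the moving interval is written as a condition
  jointly measurable in \<open>x\<close> and \<open>t\<close>, and the integral over
  \<open>t\<close> with respect to the finite measure \<open>N\<close> is then measurable in
  \<open>x\<close>. Cutting \<open>h * snd \<mu>\<close> off outside the compact interval yields an
  integrand that is Borel on the whole line.\<close>

lemma bounded_borel_on_cint:
  assumes \<mu>: "cm_on \<alpha> \<beta> \<mu>" and c: "c \<in> {\<alpha>..\<beta>}" and h: "set_integrable (fst \<mu>) {\<alpha>..\<beta>} h"
  shows "bounded_borel_on \<alpha> \<beta> (\<lambda>x. cint \<mu> c x h)"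
proof -
  define M where "M = fst \<mu>"
  define k where "k t = indicator {\<alpha>..\<beta>} t *\<^sub>R (h t * snd \<mu> t)" for t
  define N where "N = density M (\<lambda>t. ennreal (indicator {\<alpha>..\<beta>} t))"
  have M: "finite_on \<alpha> \<beta> M" using \<mu> by (simp add: cm_on_def M_def)
  have N: "finite_measure N"
    unfolding N_def ennreal_indicator by (rule finite_on_density[OF M])
  have "integrable M k"
    using cm_on_set_integrable[OF \<mu> h, of "{\<alpha>..\<beta>}"] unfolding set_integrable_def k_def M_def by simp
  then have k: "k \<in> borel_measurable borel"
    unfolding finite_on_measurable[OF M, symmetric] by (rule borel_measurable_integrable)
  have sN: "sets N = sets borel" by (simp add: N_def finite_on_sets[OF M])
  have meas: "(\<lambda>x. LINT t|N. (if Q x t then k t else 0)) \<in> borel_measurable borel"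
    if "Measurable.pred (borel \<Otimes>\<^sub>M borel) (\<lambda>(x, t). Q x t)" for Q :: "real \<Rightarrow> real \<Rightarrow> bool"
  proof (rule sigma_finite_measure.borel_measurable_lebesgue_integral)
    show "sigma_finite_measure N" using N by (rule finite_measure.axioms(1))
    have s: "sets (borel \<Otimes>\<^sub>M N) = sets (borel \<Otimes>\<^sub>M borel)" using sN by (intro sets_pair_measure_cong) auto
    have "(\<lambda>p. if case p of (x, t) \<Rightarrow> Q x t then k (snd p) else 0) \<in> borel_measurable (borel \<Otimes>\<^sub>M borel)"
      using that k by (intro measurable_If) auto
    then show "(\<lambda>(x, t). if Q x t then k t else 0) \<in> borel_measurable (borel \<Otimes>\<^sub>M N)"
      unfolding measurable_cong_sets[OF s refl] by (simp add: case_prod_beta)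
  qed
  have eq: "(LINT t:{t. Q t}|M. h t * snd \<mu> t) = (LINT t|N. (if Q t then k t else 0))"
    if "{t. Q t} \<subseteq> {\<alpha>..\<beta>}" "{t. Q t} \<in> sets borel" for Q
  proof -
    have "(LINT t|N. (if Q t then k t else 0)) = (LINT t|M. indicator {\<alpha>..\<beta>} t *\<^sub>R (if Q t then k t else 0))"
      unfolding N_def using k that
      by (intro integral_density) (auto simp: finite_on_measurable[OF M] intro!: measurable_If)
    also have "\<dots> = (LINT t:{t. Q t}|M. h t * snd \<mu> t)"
      unfolding set_lebesgue_integral_def
      by (intro Bochner_Integration.integral_cong) (use that in \<open>auto simp: k_def indicator_def\<close>)
    finally show ?thesis by simp
  qed
  define K where "K x = (if c \<le> x then LINT t|N. (if c \<le> t \<and> t < x then k t else 0)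
      else - (LINT t|N. (if x \<le> t \<and> t < c then k t else 0)))" for x
  have "K \<in> borel_measurable borel"
    unfolding K_def
    by (intro measurable_If borel_measurable_uminus meas) measurable
  moreover have "cint \<mu> c x h = K x" if "x \<in> {\<alpha>..\<beta>}" for x
  proof -
    have "{t. c \<le> t \<and> t < x} = {c..<x}" "{t. x \<le> t \<and> t < c} = {x..<c}" by auto
    moreover have "{c..<x} \<subseteq> {\<alpha>..\<beta>}" "{x..<c} \<subseteq> {\<alpha>..\<beta>}" using that c by auto
    ultimately show ?thesis
      using eq[of "\<lambda>t. c \<le> t \<and> t < x"] eq[of "\<lambda>t. x \<le> t \<and> t < c"]
      by (simp add: K_def cint_eq M_def)
  qed
  ultimately have "set_borel_measurable borel {\<alpha>..\<beta>} (\<lambda>x. cint \<mu> c x h)"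
  proof -
    assume K: "K \<in> borel_measurable borel" and "\<And>x. x \<in> {\<alpha>..\<beta>} \<Longrightarrow> cint \<mu> c x h = K x"
    then have "(\<lambda>x. indicator {\<alpha>..\<beta>} x *\<^sub>R cint \<mu> c x h) = (\<lambda>x. indicator {\<alpha>..\<beta>} x *\<^sub>R K x)"
      by (intro ext) (auto split: split_indicator)
    then show ?thesis using K by (simp add: set_borel_measurable_def)
  qed
  then show ?thesis
    unfolding bounded_borel_on_def using norm_cint_le[OF \<mu> h c] by blast
qed

section \<open>Point masses\<close>

lemma cmeasure_val_singleton:
  assumes "cm_on \<alpha> \<beta> \<mu>" "x \<in> {\<alpha>..\<beta>}"
  shows "(LINT t:{x}|fst \<mu>. h t * snd \<mu> t) = h x * cmeasure_val \<mu> {x}"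
    and "norm (cmeasure_val \<mu> {x}) = measure (fst \<mu>) {x}"
proof -
  have M: "finite_on \<alpha> \<beta> (fst \<mu>)" using assms by (simp add: cm_on_def)
  have s: "{x} \<in> sets (fst \<mu>)" "emeasure (fst \<mu>) {x} \<noteq> \<infinity>"
    using finite_on_subset[OF M, of "{x}"] assms(2) by (auto simp: finite_on_sets[OF M])
  have *: "(LINT t:{x}|fst \<mu>. g t) = measure (fst \<mu>) {x} *\<^sub>R g x" for g :: "real \<Rightarrow> complex"
  proof -
    have "(LINT t:{x}|fst \<mu>. g t) = (LINT t|fst \<mu>. indicator {x} t *\<^sub>R g x)"
      unfolding set_lebesgue_integral_def
      by (intro Bochner_Integration.integral_cong) (auto simp: indicator_def)
    then show ?thesis using s by (simp add: less_top)
  qed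
  show "(LINT t:{x}|fst \<mu>. h t * snd \<mu> t) = h x * cmeasure_val \<mu> {x}"
    by (simp add: * cmeasure_val_def)
  show "norm (cmeasure_val \<mu> {x}) = measure (fst \<mu>) {x}"
  proof (cases "measure (fst \<mu>) {x} = 0")
    case False
    \<comment> \<open>The phase has modulus 1 only almost everywhere, but at a point of positive
      mass an almost sure property holds pointwise.\<close>
    have "norm (snd \<mu> x) = 1"
    proof (rule ccontr)
      assume "norm (snd \<mu> x) \<noteq> 1"
      moreover have "AE t in fst \<mu>. norm (snd \<mu> t) = 1" using assms by (simp add: cm_on_def)
      ultimately have "AE t in fst \<mu>. t \<notin> {x}" by (auto elim!: eventually_mono)
      then have "{x} \<in> null_sets (fst \<mu>)" using s AE_iff_null_sets by blast
      then show False using False by (simp add: measure_def null_setsD1)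
    qed
    then show ?thesis by (simp add: cmeasure_val_def *)
  qed (simp add: cmeasure_val_def *)
qed

text \<open>Isolates the implicit contribution of the endpoint \<open>x\<close>, so that it can be
  moved to the other side of the equations.\<close>

lemma cint_left_split:
  assumes \<mu>: "cm_on \<alpha> \<beta> \<mu>" and h: "set_integrable (fst \<mu>) {\<alpha>..\<beta>} h"
    and x: "\<alpha> \<le> x" "x < c" "c \<le> \<beta>"
  shows "cint \<mu> c x h = - h x * cmeasure_val \<mu> {x} - (LINT t:{x<..<c}|fst \<mu>. h t * snd \<mu> t)"
proof -
  have *: "{x..<c} = {x} \<union> {x<..<c}" using x by auto
  have "(LINT t:{x..<c}|fst \<mu>. h t * snd \<mu> t)
      = (LINT t:{x}|fst \<mu>. h t * snd \<mu> t) + (LINT t:{x<..<c}|fst \<mu>. h t * snd \<mu> t)"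
    unfolding * using x by (intro set_integral_Un cm_on_set_integrable[OF \<mu> h]) auto
  moreover have "x \<in> {\<alpha>..\<beta>}" using x by auto
  ultimately show ?thesis using x cmeasure_val_singleton(1)[OF \<mu>, of x h] by (simp add: cint_eq)
qed

text \<open>The atoms of \<open>\<nu>\<close> in the interval are countable, and each is a null set
  of \<open>\<mu>\<close>: one of the two values vanishes there, and the modulus of a value is the
  mass.\<close>

lemma AE_no_common_atoms:
  assumes \<mu>: "cm_on \<alpha> \<beta> \<mu>" and \<nu>: "cm_on \<alpha> \<beta> \<nu>"
    and no: "\<And>x. x \<in> {\<alpha>..\<beta>} \<Longrightarrow> cmeasure_val \<mu> {x} * cmeasure_val \<nu> {x} = 0"
  shows "AE t in fst \<mu>. t \<in> {\<alpha>..\<beta>} \<longrightarrow> cmeasure_val \<nu> {t} = 0"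
proof -
  let ?N = "{x \<in> {\<alpha>..\<beta>}. measure (fst \<nu>) {x} \<noteq> 0}"
  have M: "finite_on \<alpha> \<beta> (fst \<mu>)" and M': "finite_on \<alpha> \<beta> (fst \<nu>)"
    using \<mu> \<nu> by (simp_all add: cm_on_def)
  have "(\<Union>x\<in>?N. {x}) \<in> null_sets (fst \<mu>)"
  proof (rule null_sets_UN'[OF finite_on_countable_atoms[OF M']])
    fix x assume x: "x \<in> ?N"
    then have "cmeasure_val \<nu> {x} \<noteq> 0" using cmeasure_val_singleton(2)[OF \<nu>, of x] by fastforce
    then have "cmeasure_val \<mu> {x} = 0" using no x by fastforce
    then have "measure (fst \<mu>) {x} = 0" using cmeasure_val_singleton(2)[OF \<mu>, of x] x by simp
    then show "{x} \<in> null_sets (fst \<mu>)"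
      using finite_on_subset[OF M, of "{x}"] x
      by (intro null_setsI) (auto simp: finite_on_sets[OF M] measure_def enn2real_eq_0_iff)
  qed
  then have "AE t in fst \<mu>. t \<notin> (\<Union>x\<in>?N. {x})" by (rule AE_not_in)
  then show ?thesis
    by eventually_elim (use cmeasure_val_singleton(2)[OF \<nu>] in force)
qed

section \<open>The first-order system\<close>

text \<open>Dividing \<open>v\<close> by \<open>r\<close>, the square root of the size of \<open>z\<close>, balances the system:
  every coefficient is then at most \<open>r\<close>. This is where the order \<open>1/2\<close> comes from.\<close>

lemma balanced_system_bound:
  fixes u v p q z :: complex
  assumes u: "u = p + s1" and v: "v = q + s2 - z * s3"
    and p: "norm p \<le> P" and q: "norm q \<le> Q"
    and s: "norm s1 \<le> r * V" "norm s2 \<le> U1" "norm s3 \<le> U2"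
    and r: "1 \<le> r" "norm z \<le> r\<^sup>2"
  shows "norm u + norm v / r \<le> (P + Q) + r * (V + U1 + U2)"
proof -
  have "0 \<le> U1" "0 \<le> U2" "0 \<le> Q"
    using s q by (meson norm_ge_zero order_trans)+
  have "norm v \<le> norm q + norm s2 + norm z * norm s3"
    unfolding v by (metis norm_mult norm_triangle_ineq norm_triangle_ineq4 add_right_mono order_trans)
  also have "\<dots> \<le> Q + U1 + r\<^sup>2 * U2"
    using q s r by (intro add_mono mult_mono) auto
  also have "\<dots> \<le> r * Q + r\<^sup>2 * U1 + r\<^sup>2 * U2"
  proof -
    have "1 \<le> r\<^sup>2" using r by simp
    then show ?thesis
      using \<open>0 \<le> U1\<close> \<open>0 \<le> Q\<close> r mult_right_mono[of 1 r Q] mult_right_mono[of 1 "r\<^sup>2" U1] by simp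
  qed
  also have "\<dots> = r * (Q + r * U1 + r * U2)" by (simp add: power2_eq_square algebra_simps)
  finally have "norm v / r \<le> Q + r * U1 + r * U2" using r by (simp add: divide_le_eq mult.commute)
  moreover have "norm u \<le> P + r * V"
    unfolding u using p s(1) by (metis norm_triangle_ineq add_mono order_trans)
  ultimately show ?thesis by (simp add: algebra_simps)
qed

text \<open>Here \<open>[c,x)\<close> does not contain \<open>x\<close>, so the balanced norm
  satisfies the integral inequality directly. The sources \<open>p\<close> and \<open>q\<close> are
  functions because the inhomogeneity \<open>g\<close> and, later, the sources of the difference
  quotients enter through them.\<close>

lemma system_bound_right:
  fixes u v p q :: "real \<Rightarrow> complex"
  assumes R: "cm_on \<alpha> \<beta> rho" and S: "cm_on \<alpha> \<beta> vsig" and X: "cm_on \<alpha> \<beta> chi"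
    and u: "bounded_borel_on \<alpha> \<beta> u" and v: "bounded_borel_on \<alpha> \<beta> v" and c: "\<alpha> \<le> c"
    and equ: "\<And>x. c \<le> x \<Longrightarrow> x \<le> \<beta> \<Longrightarrow> u x = p x + cint vsig c x v"
    and eqv: "\<And>x. c \<le> x \<Longrightarrow> x \<le> \<beta> \<Longrightarrow> v x = q x + cint chi c x u - z * cint rho c x u"
    and p: "\<And>x. c \<le> x \<Longrightarrow> x \<le> \<beta> \<Longrightarrow> norm (p x) \<le> P"
    and q: "\<And>x. c \<le> x \<Longrightarrow> x \<le> \<beta> \<Longrightarrow> norm (q x) \<le> Q"
    and r: "1 \<le> r" "norm z \<le> r\<^sup>2" and x: "c \<le> x" "x \<le> \<beta>"
  shows "norm (u x) + norm (v x) / r \<le> (P + Q) * exp (2 * (r *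
    (measure (fst vsig) {\<alpha>..\<beta>} + measure (fst chi) {\<alpha>..\<beta>} + measure (fst rho) {\<alpha>..\<beta>})))"
proof -
  let ?M = "\<lambda>i::nat. if i = 0 then fst vsig else if i = 1 then fst chi else fst rho"
  let ?U = "\<lambda>i::nat. if i = 0 then (\<lambda>t. norm (v t) / r) else (\<lambda>t. norm (u t))"
  have M: "finite_on \<alpha> \<beta> (?M i)" for i
    using R S X by (auto simp: cm_on_def)
  have n: "set_integrable (fst \<mu>) {\<alpha>..\<beta>} (\<lambda>t. norm (w t))"
    if "cm_on \<alpha> \<beta> \<mu>" "bounded_borel_on \<alpha> \<beta> w" for w \<mu>
    using integrable_norm[OF bounded_borel_on_set_integrable[OF _ that(2), unfolded set_integrable_def]] that(1)
    by (simp add: set_integrable_def cm_on_def)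
  have PQ: "0 \<le> P" "0 \<le> Q"
    using p[OF x] q[OF x] by (meson norm_ge_zero order_trans)+
  have "norm (u x) + norm (v x) / r \<le> (P + Q) * exp (2 * weighted_measure r {0,1,2} ?M {\<alpha>..\<beta>})"
  proof (rule integral_gronwall_right[where J = "{0,1,2::nat}" and M = ?M and U = ?U and c = c
        and y = "\<lambda>x. norm (u x) + norm (v x) / r"])
    fix x assume x: "c \<le> x" "x \<le> \<beta>"
    have sub: "{c..<x} \<in> sets borel" "{c..<x} \<subseteq> {\<alpha>..\<beta>}" using x c by auto
    have le: "norm (cint \<mu> c x w) \<le> (LINT t:{c..<x}|fst \<mu>. norm (w t))"
      if "cm_on \<alpha> \<beta> \<mu>" "bounded_borel_on \<alpha> \<beta> w" for \<mu> w
      using cm_on_norm_integral_le[OF that(1) bounded_borel_on_set_integrable[OF _ that(2)] sub] that(1) x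
      by (simp add: cint_eq cm_on_def)
    have "norm (u x) + norm (v x) / r \<le> (P + Q) + r * ((LINT t:{c..<x}|fst vsig. norm (v t) / r)
        + (LINT t:{c..<x}|fst chi. norm (u t)) + (LINT t:{c..<x}|fst rho. norm (u t)))"
      using le[OF S v] le[OF X u] le[OF R u] r
      by (intro balanced_system_bound[OF equ[OF x] eqv[OF x] p[OF x] q[OF x]]) auto
    then show "norm (u x) + norm (v x) / r \<le>
        (P + Q) + r * (\<Sum>i\<in>{0,1,2}. LINT t:{c..<x}|?M i. ?U i t)" by (simp add: add.assoc)
  qed (use M n[OF X u] n[OF R u] n[OF S v] r x c PQ in \<open>auto intro!: set_integrable_divide\<close>)
  then show ?thesis by (simp add: weighted_measure_def add.assoc)
qed

text \<open>To the left of \<open>c\<close> the integrals run over \<open>[x,c)\<close> and contain the atom at \<open>x\<close>. Passing to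
  the right limits \<open>u'\<close>, \<open>v'\<close> removes it; as \<open>vsig\<close> has no atom in common with \<open>rho\<close> and \<open>chi\<close>,
  the integrands do not notice the change.\<close>

lemma system_bound_left:
  fixes u v p q :: "real \<Rightarrow> complex"
  assumes R: "cm_on \<alpha> \<beta> rho" and S: "cm_on \<alpha> \<beta> vsig" and X: "cm_on \<alpha> \<beta> chi"
    and SR: "\<And>x. x \<in> {\<alpha>..\<beta>} \<Longrightarrow> cmeasure_val vsig {x} * cmeasure_val rho {x} = 0"
    and SX: "\<And>x. x \<in> {\<alpha>..\<beta>} \<Longrightarrow> cmeasure_val vsig {x} * cmeasure_val chi {x} = 0"
    and u: "bounded_borel_on \<alpha> \<beta> u" and v: "bounded_borel_on \<alpha> \<beta> v" and c: "c \<le> \<beta>"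
    and equ: "\<And>x. \<alpha> \<le> x \<Longrightarrow> x \<le> c \<Longrightarrow> u x = p x + cint vsig c x v"
    and eqv: "\<And>x. \<alpha> \<le> x \<Longrightarrow> x \<le> c \<Longrightarrow> v x = q x + cint chi c x u - z * cint rho c x u"
    and p: "\<And>x. \<alpha> \<le> x \<Longrightarrow> x \<le> c \<Longrightarrow> norm (p x) \<le> P"
    and q: "\<And>x. \<alpha> \<le> x \<Longrightarrow> x \<le> c \<Longrightarrow> norm (q x) \<le> Q"
    and r: "1 \<le> r" "norm z \<le> r\<^sup>2" and x: "\<alpha> \<le> x" "x < c"
  defines "u' \<equiv> \<lambda>x. if x < c then u x + v x * cmeasure_val vsig {x} else u x"
    and "v' \<equiv> \<lambda>x. if x < c then v x + u x * cmeasure_val chi {x} - z * (u x * cmeasure_val rho {x}) else v x"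
  shows "norm (u' x) + norm (v' x) / r \<le> (P + Q) * exp (2 * (r *
    (measure (fst vsig) {\<alpha>..\<beta>} + measure (fst chi) {\<alpha>..\<beta>} + measure (fst rho) {\<alpha>..\<beta>})))"
proof -
  let ?M = "\<lambda>i::nat. if i = 0 then fst vsig else if i = 1 then fst chi else fst rho"
  let ?U = "\<lambda>i::nat. if i = 0 then (\<lambda>t. norm (v t) / r) else (\<lambda>t. norm (u t))"
  let ?y = "\<lambda>x. norm (u' x) + norm (v' x) / r"
  have M: "finite_on \<alpha> \<beta> (?M i)" for i
    using R S X by (auto simp: cm_on_def)
  have i: "set_integrable (fst \<mu>) {\<alpha>..\<beta>} w" if "cm_on \<alpha> \<beta> \<mu>" "bounded_borel_on \<alpha> \<beta> w" for \<mu> w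
    using bounded_borel_on_set_integrable that by (auto simp: cm_on_def)
  have n: "set_integrable (fst \<mu>) {\<alpha>..\<beta>} (\<lambda>t. norm (w t))"
    if "cm_on \<alpha> \<beta> \<mu>" "bounded_borel_on \<alpha> \<beta> w" for w \<mu>
    using integrable_norm[OF bounded_borel_on_set_integrable[OF _ that(2), unfolded set_integrable_def]] that(1)
    by (simp add: set_integrable_def cm_on_def)
  have PQ: "0 \<le> P" "0 \<le> Q"
    using p[of x] q[of x] x by (meson norm_ge_zero order_trans less_imp_le)+
  have "AE t in fst vsig. t \<in> {\<alpha>..\<beta>} \<longrightarrow> norm (v t) / r \<le> ?y t"
  proof -
    have "AE t in fst vsig. t \<in> {\<alpha>..\<beta>} \<longrightarrow> cmeasure_val rho {t} = 0"
      by (rule AE_no_common_atoms[OF S R]) (rule SR)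
    moreover have "AE t in fst vsig. t \<in> {\<alpha>..\<beta>} \<longrightarrow> cmeasure_val chi {t} = 0"
      by (rule AE_no_common_atoms[OF S X]) (rule SX)
    ultimately show ?thesis by eventually_elim (use r in \<open>auto simp: v'_def\<close>)
  qed
  moreover have "AE t in fst \<mu>. t \<in> {\<alpha>..\<beta>} \<longrightarrow> norm (u t) \<le> ?y t"
    if "cm_on \<alpha> \<beta> \<mu>" "\<And>x. x \<in> {\<alpha>..\<beta>} \<Longrightarrow> cmeasure_val vsig {x} * cmeasure_val \<mu> {x} = 0" for \<mu>
  proof -
    have "AE t in fst \<mu>. t \<in> {\<alpha>..\<beta>} \<longrightarrow> cmeasure_val vsig {t} = 0"
      using that(2) by (intro AE_no_common_atoms[OF that(1) S]) (simp add: mult.commute)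
    then show ?thesis by eventually_elim (use r in \<open>auto simp: u'_def\<close>)
  qed
  ultimately have Uy: "AE t in ?M i. t \<in> {\<alpha>..\<beta>} \<longrightarrow> ?U i t \<le> ?y t" if "i \<in> {0,1,2}" for i
    using that R X SR SX by auto
  have "?y x \<le> (P + Q) * exp (2 * weighted_measure r {0,1,2} ?M {\<alpha>..\<beta>})"
  proof (rule integral_gronwall_left[where J = "{0,1,2::nat}" and M = ?M and U = ?U and c = c and y = ?y])
    fix x assume x: "\<alpha> \<le> x" "x \<le> c"
    let ?I = "\<lambda>\<mu> w. LINT t:{x<..<c}|fst \<mu>. w t * snd \<mu> t"
    have sub: "{x<..<c} \<in> sets borel" "{x<..<c} \<subseteq> {\<alpha>..\<beta>}" using x c by auto
    have le: "norm (?I \<mu> w) \<le> (LINT t:{x<..<c}|fst \<mu>. norm (w t))"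
      if "cm_on \<alpha> \<beta> \<mu>" "bounded_borel_on \<alpha> \<beta> w" for \<mu> w
      by (rule cm_on_norm_integral_le[OF that(1) i[OF that] sub])
    \<comment> \<open>For \<open>x < c\<close> the added term cancels the atom split off from
      \<open>[x,c)\<close>. At \<open>x = c\<close> nothing is added: the integral is over the empty
      set there.\<close>
    have u': "u' x = p x + - ?I vsig v"
    proof (cases "x = c")
      case True
      then show ?thesis using equ[OF x] by (simp add: u'_def set_lebesgue_integral_def)
    next
      case False
      then show ?thesis using equ[OF x] cint_left_split[OF S i[OF S v], of x c] x c by (simp add: u'_def)
    qed
    have v': "v' x = q x + - ?I chi u - z * (- ?I rho u)"
    proof (cases "x = c")
      case True
      then show ?thesis using eqv[OF x] by (simp add: v'_def set_lebesgue_integral_def)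
    next
      case False
      then have xc: "x < c" using x by simp
      show ?thesis
        using eqv[OF x] cint_left_split[OF X i[OF X u] x(1) xc c] cint_left_split[OF R i[OF R u] x(1) xc c] xc
        by (simp add: v'_def algebra_simps)
    qed
    have "?y x \<le> (P + Q) + r * ((LINT t:{x<..<c}|fst vsig. norm (v t) / r)
        + (LINT t:{x<..<c}|fst chi. norm (u t)) + (LINT t:{x<..<c}|fst rho. norm (u t)))"
      using le[OF S v] le[OF X u] le[OF R u] r
      by (intro balanced_system_bound[OF u' v' p[OF x] q[OF x]]) auto
    then show "?y x \<le> (P + Q) + r * (\<Sum>i\<in>{0,1,2}. LINT t:{x<..<c}|?M i. ?U i t)" by (simp add: add.assoc)
  qed (use M n[OF X u] n[OF R u] n[OF S v] Uy r x c PQ in \<open>auto intro!: set_integrable_divide\<close>)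
  then show ?thesis by (simp add: weighted_measure_def add.assoc)
qed

text \<open>The jump has determinant \<open>1 - s * (x - z * w)\<close>, which could vanish for some
  \<open>z\<close> if \<open>s * w\<close> were nonzero; here it equals 1. Either
  \<open>s = 0\<close>, and \<open>u\<close> is unchanged, or \<open>x = w = 0\<close>, and
  \<open>v\<close> is unchanged; the unchanged component then gives back the other. The further
  factor \<open>r\<close> removes the weight \<open>1 / r\<close>.\<close>

lemma undo_right_limit_bound:
  fixes u v :: complex
  assumes uv: "u' = u + v * s" "v' = v + u * x - z * (u * w)"
    and no: "s * x = 0" "s * w = 0"
    and T: "norm s \<le> T" "norm x + norm w \<le> T"
    and r: "1 \<le> r" "norm z \<le> r\<^sup>2"
  shows "norm u + norm v \<le> (1 + r\<^sup>2 * T) * (r * (norm u' + norm v' / r))"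
proof -
  have T0: "0 \<le> T" using T(1) norm_ge_zero order_trans by blast
  have r2: "1 \<le> r\<^sup>2" using r by simp
  have "norm u + norm v \<le> (1 + r\<^sup>2 * T) * (norm u' + norm v')"
  proof (cases "s = 0")
    case True
    then have u: "u = u'" using uv by simp
    have "norm v = norm (v' - u' * x + z * (u' * w))" using uv u by simp
    also have "\<dots> \<le> norm v' + norm (u' * x) + norm (z * (u' * w))"
      by (rule order_trans[OF norm_triangle_ineq add_right_mono[OF norm_triangle_ineq4]])
    also have "\<dots> = norm v' + norm u' * norm x + norm z * (norm u' * norm w)"
      by (simp add: norm_mult)
    also have "\<dots> \<le> norm v' + r\<^sup>2 * (norm u' * norm x) + r\<^sup>2 * (norm u' * norm w)"
      using r r2 mult_right_mono[OF r2, of "norm u' * norm x"] by (intro add_mono mult_right_mono) auto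
    also have "\<dots> = norm v' + norm u' * (r\<^sup>2 * (norm x + norm w))" by (simp add: algebra_simps)
    also have "\<dots> \<le> norm v' + norm u' * (r\<^sup>2 * T)"
      using T(2) by (intro add_left_mono mult_left_mono) auto
    finally have "norm u + norm v \<le> (norm u' + norm v') + (r\<^sup>2 * T) * norm u'"
      using u by (simp add: algebra_simps)
    also have "\<dots> \<le> (norm u' + norm v') + (r\<^sup>2 * T) * (norm u' + norm v')"
      using T0 by (intro add_left_mono mult_left_mono) auto
    finally show ?thesis by (simp add: algebra_simps)
  next
    case False
    then have v: "v = v'" using uv no by simp
    have "norm u = norm (u' - v' * s)" unfolding uv(1) v[symmetric] by simp
    also have "\<dots> \<le> norm u' + norm v' * norm s" by (metis norm_mult norm_triangle_ineq4)
    also have "\<dots> \<le> norm u' + norm v' * (r\<^sup>2 * T)"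
      using T(1) T0 mult_right_mono[OF r2 T0] by (intro add_left_mono mult_left_mono) auto
    finally have "norm u + norm v \<le> (norm u' + norm v') + (r\<^sup>2 * T) * norm v'"
      using v by (simp add: algebra_simps)
    also have "\<dots> \<le> (norm u' + norm v') + (r\<^sup>2 * T) * (norm u' + norm v')"
      using T0 by (intro add_left_mono mult_left_mono) auto
    finally show ?thesis by (simp add: algebra_simps)
  qed
  also have "\<dots> \<le> (1 + r\<^sup>2 * T) * (r * (norm u' + norm v' / r))"
  proof (intro mult_left_mono)
    show "norm u' + norm v' \<le> r * (norm u' + norm v' / r)"
      using r mult_right_mono[of 1 r "norm u'"] by (simp add: algebra_simps)
  qed (use T0 in simp)
  finally show ?thesis .
qed

text \<open>With \<open>s\<close> the root of the size of \<open>z\<close>, two powers of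
  \<open>1 + s\<close> stem from inverting the jump and one from the weight \<open>1 / r\<close>.
  Each costs a factor \<open>exp (1 + s)\<close>, whence the 3 next to \<open>2 * T\<close>.\<close>

lemma cubic_exp_bound:
  fixes s T :: real
  assumes "0 \<le> s" "0 \<le> T"
  shows "(1 + (1 + s)\<^sup>2 * T) * ((1 + s) * exp (2 * ((1 + s) * T)))
    \<le> (1 + T) * exp (3 + 2 * T) * exp ((3 + 2 * T) * s)"
proof -
  have e: "1 + s \<le> exp (1 + s)" using exp_ge_add_one_self[of "1 + s"] by linarith
  have "1 + (1 + s)\<^sup>2 * T \<le> (1 + T) * (1 + s)\<^sup>2"
    using assms one_le_power[of "1 + s" 2] by (simp add: algebra_simps)
  then have "(1 + (1 + s)\<^sup>2 * T) * (1 + s) \<le> (1 + T) * (1 + s) ^ 3"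
    using assms mult_right_mono[of _ _ "1 + s"] by (fastforce simp: power3_eq_cube power2_eq_square mult.assoc)
  also have "\<dots> \<le> (1 + T) * exp (1 + s) ^ 3"
    using assms e by (intro mult_left_mono power_mono) auto
  also have "exp (1 + s) ^ 3 = exp (3 * (1 + s))" by (simp add: exp_of_nat_mult[symmetric])
  finally have "(1 + (1 + s)\<^sup>2 * T) * (1 + s) * exp (2 * ((1 + s) * T))
      \<le> (1 + T) * exp (3 * (1 + s)) * exp (2 * ((1 + s) * T))"
    by (rule mult_right_mono) simp
  also have "\<dots> = (1 + T) * exp (3 * (1 + s) + 2 * ((1 + s) * T))"
    by (simp only: exp_add mult.assoc)
  also have "3 * (1 + s) + 2 * ((1 + s) * T) = (3 + 2 * T) + (3 + 2 * T) * s" by (simp add: algebra_simps)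
  finally show ?thesis by (simp only: exp_add mult.assoc)
qed

lemma system_bound:
  fixes u v p q :: "real \<Rightarrow> complex"
  assumes R: "cm_on \<alpha> \<beta> rho" and S: "cm_on \<alpha> \<beta> vsig" and X: "cm_on \<alpha> \<beta> chi"
    and SR: "\<And>x. x \<in> {\<alpha>..\<beta>} \<Longrightarrow> cmeasure_val vsig {x} * cmeasure_val rho {x} = 0"
    and SX: "\<And>x. x \<in> {\<alpha>..\<beta>} \<Longrightarrow> cmeasure_val vsig {x} * cmeasure_val chi {x} = 0"
    and u: "bounded_borel_on \<alpha> \<beta> u" and v: "bounded_borel_on \<alpha> \<beta> v" and c: "c \<in> {\<alpha>..\<beta>}"
    and equ: "\<And>x. x \<in> {\<alpha>..\<beta>} \<Longrightarrow> u x = p x + cint vsig c x v"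
    and eqv: "\<And>x. x \<in> {\<alpha>..\<beta>} \<Longrightarrow> v x = q x + cint chi c x u - z * cint rho c x u"
    and p: "\<And>x. x \<in> {\<alpha>..\<beta>} \<Longrightarrow> norm (p x) \<le> P"
    and q: "\<And>x. x \<in> {\<alpha>..\<beta>} \<Longrightarrow> norm (q x) \<le> Q"
    and x: "x \<in> {\<alpha>..\<beta>}"
  defines "T \<equiv> measure (fst vsig) {\<alpha>..\<beta>} + measure (fst chi) {\<alpha>..\<beta>} + measure (fst rho) {\<alpha>..\<beta>}"
  shows "norm (u x) + norm (v x)
    \<le> (P + Q) * ((1 + T) * exp (3 + 2 * T) * exp ((3 + 2 * T) * sqrt (norm z)))"
proof -
  \<comment> \<open>The summand 1 keeps \<open>r \<ge> 1\<close> near \<open>z = 0\<close>, so that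
    dividing by \<open>r\<close> stays harmless there.\<close>
  define r where "r = 1 + sqrt (norm z)"
  have r: "1 \<le> r" "norm z \<le> r\<^sup>2"
    by (simp_all add: r_def power2_sum)
  have T0: "0 \<le> T" by (simp add: T_def)
  have PQ: "0 \<le> P" "0 \<le> Q"
    using p[OF x] q[OF x] by (meson norm_ge_zero order_trans)+
  have bound: "norm (u x) + norm (v x) \<le> (1 + r\<^sup>2 * T) * (r * ((P + Q) * exp (2 * (r * T))))"
  proof (cases "c \<le> x")
    case True
    have y: "norm (u x) + norm (v x) / r \<le> (P + Q) * exp (2 * (r * T))"
      unfolding T_def
      by (rule system_bound_right[OF R S X u v, of c p q z]) (use c x True r equ eqv p q in auto)
    \<comment> \<open>There is no jump to undo on this side; with zero masses the lemma only removes
      the weight \<open>1 / r\<close> and produces the same bound as on the left.\<close>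
    have "norm (u x) + norm (v x) \<le> (1 + r\<^sup>2 * T) * (r * (norm (u x) + norm (v x) / r))"
      by (rule undo_right_limit_bound[where s = 0 and x = 0 and w = 0]) (use T0 r in auto)
    also have "\<dots> \<le> (1 + r\<^sup>2 * T) * (r * ((P + Q) * exp (2 * (r * T))))"
      using y r T0 by (intro mult_left_mono) auto
    finally show ?thesis .
  next
    case False
    let ?u = "u x + v x * cmeasure_val vsig {x}"
    let ?v = "v x + u x * cmeasure_val chi {x} - z * (u x * cmeasure_val rho {x})"
    have y: "norm ?u + norm ?v / r \<le> (P + Q) * exp (2 * (r * T))"
      using system_bound_left[OF R S X SR SX u v, of c p q z P Q r x] c x False r equ eqv p q
      by (simp add: T_def)
    have le: "norm (cmeasure_val \<mu> {x}) \<le> measure (fst \<mu>) {\<alpha>..\<beta>}" if "cm_on \<alpha> \<beta> \<mu>" for \<mu>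
      using cmeasure_val_singleton(2)[OF that x] finite_on_measure_mono[of \<alpha> \<beta> "fst \<mu>" "{x}" "{\<alpha>..\<beta>}"] that x
      by (simp add: cm_on_def)
    have "norm (cmeasure_val vsig {x}) \<le> T"
      "norm (cmeasure_val chi {x}) + norm (cmeasure_val rho {x}) \<le> T"
      using le[OF S] le[OF X] le[OF R] measure_nonneg[of "fst vsig" "{\<alpha>..\<beta>}"]
        measure_nonneg[of "fst chi" "{\<alpha>..\<beta>}"] measure_nonneg[of "fst rho" "{\<alpha>..\<beta>}"]
      unfolding T_def by linarith+
    then have "norm (u x) + norm (v x) \<le> (1 + r\<^sup>2 * T) * (r * (norm ?u + norm ?v / r))"
      by (rule undo_right_limit_bound[OF refl refl SX[OF x] SR[OF x] _ _ r])
    also have "\<dots> \<le> (1 + r\<^sup>2 * T) * (r * ((P + Q) * exp (2 * (r * T))))"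
      using y r T0 by (intro mult_left_mono) auto
    finally show ?thesis .
  qed
  also have "\<dots> = (P + Q) * ((1 + r\<^sup>2 * T) * (r * exp (2 * (r * T))))" by (simp add: algebra_simps)
  also have "\<dots> \<le> (P + Q) * ((1 + T) * exp (3 + 2 * T) * exp ((3 + 2 * T) * sqrt (norm z)))"
    using cubic_exp_bound[of "sqrt (norm z)" T] T0 PQ unfolding r_def by (intro mult_left_mono) auto
  finally show ?thesis .
qed

section \<open>Dependence on the spectral parameter\<close>

text \<open>No candidate for the derivative is needed: the difference quotient is uniformly
  continuous on the punctured ball, so by completeness it has a limit at the centre.\<close>

lemma quotient_lipschitz_imp_field_differentiable:
  fixes \<phi> :: "complex \<Rightarrow> complex"
  assumes lip: "\<And>z z'. z \<in> ball \<zeta> 1 - {\<zeta>} \<Longrightarrow> z' \<in> ball \<zeta> 1 - {\<zeta>} \<Longrightarrow>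
      norm ((\<phi> z - \<phi> \<zeta>) / (z - \<zeta>) - (\<phi> z' - \<phi> \<zeta>) / (z' - \<zeta>)) \<le> norm (z - z') * L"
  shows "\<phi> field_differentiable at \<zeta>"
proof -
  define X where "X = ball \<zeta> 1 - {\<zeta>}"
  let ?D = "\<lambda>z. (\<phi> z - \<phi> \<zeta>) / (z - \<zeta>)"
  have "uniformly_continuous_on X ?D"
    unfolding uniformly_continuous_on_def
  proof (intro allI impI)
    fix e :: real assume e: "e > 0"
    show "\<exists>d>0. \<forall>x\<in>X. \<forall>x'\<in>X. dist x' x < d \<longrightarrow> dist (?D x') (?D x) < e"
    proof (intro exI[of _ "e / (\<bar>L\<bar> + 1)"] conjI ballI impI)
      fix x x' assume x: "x \<in> X" "x' \<in> X" "dist x' x < e / (\<bar>L\<bar> + 1)"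
      have "dist (?D x') (?D x) \<le> norm (x' - x) * L"
        using lip[of x' x] x by (simp add: X_def dist_norm)
      also have "\<dots> \<le> norm (x' - x) * (\<bar>L\<bar> + 1)" by (intro mult_left_mono) auto
      also have "\<dots> < e" using x(3) by (simp add: dist_norm less_divide_eq)
      finally show "dist (?D x') (?D x) < e" .
    qed (use e in simp)
  qed
  moreover have "\<zeta> \<in> closure X"
    unfolding X_def islimpt_in_closure[symmetric] by (simp add: islimpt_ball)
  ultimately obtain l where "(?D \<longlongrightarrow> l) (at \<zeta> within X)"
    using uniformly_continuous_on_extension_at_closure by blast
  moreover have "at \<zeta> within X = at \<zeta>"
  proof -
    have "at \<zeta> within X = at \<zeta> within ball \<zeta> 1" by (simp add: X_def at_within_def)
    also have "\<dots> = at \<zeta>" by (rule at_within_open) auto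
    finally show ?thesis .
  qed
  ultimately show ?thesis
    unfolding field_differentiable_def has_field_derivative_iff by auto
qed

text \<open>\<open>entire_order\<close> compares with \<open>exp (norm z powr \<rho>)\<close>
  without constants, so \<open>B\<close> and \<open>C\<close> are absorbed by enlarging the exponent
  by \<open>e\<close>. For \<open>t \<ge> 1\<close> they combine into
  \<open>exp (D * sqrt t)\<close>, and \<open>D \<le> t powr e\<close> as soon as
  \<open>t \<ge> D powr (1 / e)\<close>.\<close>

lemma entire_order_le_half:
  fixes \<phi> :: "complex \<Rightarrow> complex"
  assumes bound: "\<And>z. norm (\<phi> z) \<le> C * exp (B * sqrt (norm z))"
  shows "entire_order \<phi> \<le> ereal (1/2)"
proof (rule ereal_le_epsilon2)
  fix e :: real assume e: "0 < e"
  define D where "D = \<bar>B\<bar> + \<bar>C\<bar> + 1"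
  have D: "1 \<le> D" by (simp add: D_def)
  have "eventually (\<lambda>t. max 1 (D powr (1 / e)) \<le> t) at_top" by (rule eventually_ge_at_top)
  then have "eventually (\<lambda>t. C * exp (B * sqrt t) \<le> exp (t powr (1/2 + e))) at_top"
  proof eventually_elim
    case (elim t)
    then have t: "1 \<le> t" "D powr (1 / e) \<le> t" by auto
    have "D = (D powr (1 / e)) powr e" using D e by (simp add: powr_powr)
    also have "\<dots> \<le> t powr e" using t e by (intro powr_mono2) auto
    finally have De: "D \<le> t powr e" .
    have "C \<le> exp (\<bar>C\<bar> + 1)" using exp_ge_add_one_self[of "\<bar>C\<bar> + 1"] by linarith
    then have "C * exp (B * sqrt t) \<le> exp (\<bar>C\<bar> + 1) * exp (\<bar>B\<bar> * sqrt t)"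
      using t by (intro mult_mono) (auto intro: mult_right_mono)
    also have "\<dots> = exp (\<bar>C\<bar> + 1 + \<bar>B\<bar> * sqrt t)" by (simp add: exp_add)
    also have "\<dots> \<le> exp (D * sqrt t)"
      using t mult_left_mono[of 1 "sqrt t" "\<bar>C\<bar> + 1"] by (simp add: D_def algebra_simps)
    also have "\<dots> \<le> exp (t powr e * sqrt t)" using De t by (simp add: mult_right_mono)
    also have "t powr e * sqrt t = t powr (1/2 + e)" using t by (simp add: powr_add powr_half_sqrt)
    finally show ?case .
  qed
  then have "eventually (\<lambda>z::complex. C * exp (B * sqrt (norm z)) \<le> exp (norm z powr (1/2 + e))) at_infinity"
    using filterlim_norm_at_top by (rule eventually_compose_filterlim)
  then have "eventually (\<lambda>z. norm (\<phi> z) \<le> exp (norm z powr (1/2 + e))) at_infinity"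
    by eventually_elim (use bound order_trans in blast)
  then have "entire_order \<phi> \<le> ereal (1/2 + e)"
    unfolding entire_order_def using e by (intro Inf_lower) (auto intro!: exI[of _ "1/2 + e"])
  then show "entire_order \<phi> \<le> ereal (1/2) + ereal e" by simp
qed

text \<open>The difference quotients in \<open>z\<close> at \<open>\<zeta>\<close> solve the same system with zero initial values and
  source \<open>- cint rho c x (u \<zeta>)\<close>, so they stay bounded; differences of two quotients solve it with
  a source proportional to \<open>z - z'\<close>. Hence the quotients are Lipschitz in \<open>z\<close> and converge.\<close>

lemma system_family_differentiable:
  fixes u v :: "complex \<Rightarrow> real \<Rightarrow> complex"
  assumes R: "cm_on \<alpha> \<beta> rho" and S: "cm_on \<alpha> \<beta> vsig" and X: "cm_on \<alpha> \<beta> chi"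
    and SR: "\<And>x. x \<in> {\<alpha>..\<beta>} \<Longrightarrow> cmeasure_val vsig {x} * cmeasure_val rho {x} = 0"
    and SX: "\<And>x. x \<in> {\<alpha>..\<beta>} \<Longrightarrow> cmeasure_val vsig {x} * cmeasure_val chi {x} = 0"
    and u: "\<And>z. bounded_borel_on \<alpha> \<beta> (u z)" and v: "\<And>z. bounded_borel_on \<alpha> \<beta> (v z)"
    and c: "c \<in> {\<alpha>..\<beta>}"
    and equ: "\<And>z x. x \<in> {\<alpha>..\<beta>} \<Longrightarrow> u z x = p x + cint vsig c x (v z)"
    and eqv: "\<And>z x. x \<in> {\<alpha>..\<beta>} \<Longrightarrow> v z x = q x + cint chi c x (u z) - z * cint rho c x (u z)"
    and x: "x \<in> {\<alpha>..\<beta>}"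
  shows "(\<lambda>z. u z x) field_differentiable at \<zeta>" "(\<lambda>z. v z x) field_differentiable at \<zeta>"
proof -
  define T where "T = measure (fst vsig) {\<alpha>..\<beta>} + measure (fst chi) {\<alpha>..\<beta>} + measure (fst rho) {\<alpha>..\<beta>}"
  \<comment> \<open>The growth factor of \<open>system_bound\<close> taken at
    \<open>norm \<zeta> + 1\<close>, hence valid for all \<open>z\<close> in the unit ball around
    \<open>\<zeta>\<close>.\<close>
  define K where "K = (1 + T) * exp (3 + 2 * T) * exp ((3 + 2 * T) * sqrt (norm \<zeta> + 1))"
  define mR where "mR = measure (fst rho) {\<alpha>..\<beta>}"
  have T0: "0 \<le> T" and mR0: "0 \<le> mR" by (simp_all add: T_def mR_def)
  have i: "set_integrable (fst \<mu>) {\<alpha>..\<beta>} w" if "cm_on \<alpha> \<beta> \<mu>" "bounded_borel_on \<alpha> \<beta> w" for \<mu> w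
    using bounded_borel_on_set_integrable that by (auto simp: cm_on_def)
  have bound: "norm (w x) + norm (y x) \<le> Q * K"
    if z: "z \<in> ball \<zeta> 1 - {\<zeta>}" and w: "bounded_borel_on \<alpha> \<beta> w" and y: "bounded_borel_on \<alpha> \<beta> y"
      and eqw: "\<And>x. x \<in> {\<alpha>..\<beta>} \<Longrightarrow> w x = cint vsig c x y"
      and eqy: "\<And>x. x \<in> {\<alpha>..\<beta>} \<Longrightarrow> y x = s x + cint chi c x w - z * cint rho c x w"
      and s: "\<And>x. x \<in> {\<alpha>..\<beta>} \<Longrightarrow> norm (s x) \<le> Q" and x: "x \<in> {\<alpha>..\<beta>}"
    for z w y s Q x
  proof -
    have Q: "0 \<le> Q" using s[OF x] norm_ge_zero order_trans by blast
    have "norm (w x) + norm (y x)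
        \<le> (0 + Q) * ((1 + T) * exp (3 + 2 * T) * exp ((3 + 2 * T) * sqrt (norm z)))"
      unfolding T_def
      by (rule system_bound[OF R S X SR SX w y c, where p = "\<lambda>_. 0" and q = s]) (use eqw eqy s x in auto)
    also have "\<dots> \<le> (0 + Q) * K"
    proof -
      have "norm z \<le> norm \<zeta> + 1"
        using z norm_triangle_ineq2[of z \<zeta>] by (simp add: dist_norm norm_minus_commute)
      then show ?thesis unfolding K_def using T0 Q by (intro mult_left_mono) (auto intro!: mult_left_mono)
    qed
    finally show ?thesis by simp
  qed
  \<comment> \<open>A multiple rather than a quotient, to match the linearity of
    \<open>cint\<close>. At \<open>z = \<zeta>\<close> the value is 0, so boundedness and
    measurability hold for every \<open>z\<close>.\<close>
  define du where "du z t = inverse (z - \<zeta>) * (u z t - u \<zeta> t)" for z t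
  define dv where "dv z t = inverse (z - \<zeta>) * (v z t - v \<zeta> t)" for z t
  have du: "bounded_borel_on \<alpha> \<beta> (du z)" and dv: "bounded_borel_on \<alpha> \<beta> (dv z)" for z
    unfolding du_def dv_def by (intro bounded_borel_on_mult bounded_borel_on_diff u v)+
  have cint_du: "cint \<mu> c t (du z) = inverse (z - \<zeta>) * (cint \<mu> c t (u z) - cint \<mu> c t (u \<zeta>))"
    and cint_dv: "cint \<mu> c t (dv z) = inverse (z - \<zeta>) * (cint \<mu> c t (v z) - cint \<mu> c t (v \<zeta>))"
    if "cm_on \<alpha> \<beta> \<mu>" "t \<in> {\<alpha>..\<beta>}" for \<mu> t z
    unfolding du_def dv_def cint_mult
    by (simp_all add: cint_diff[OF that(1) c that(2) i[OF that(1) u] i[OF that(1) u]]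
        cint_diff[OF that(1) c that(2) i[OF that(1) v] i[OF that(1) v]])
  have eq_du: "du z t = cint vsig c t (dv z)" if "t \<in> {\<alpha>..\<beta>}" for z t
    unfolding cint_dv[OF S that] by (simp add: du_def equ[OF that])
  \<comment> \<open>The source arises from \<open>z * Rz - \<zeta> * R\<zeta> = z * (Rz - R\<zeta>)
    + (z - \<zeta>) * R\<zeta>\<close>, where \<open>R\<close> stands for the integral against
    \<open>rho\<close>.\<close>
  have eq_dv: "dv z t = - cint rho c t (u \<zeta>) + cint chi c t (du z) - z * cint rho c t (du z)"
    if "t \<in> {\<alpha>..\<beta>}" "z \<noteq> \<zeta>" for z t
  proof -
    have "w * (q' + Xz - z * Rz - (q' + X\<zeta> - \<zeta> * R\<zeta>)) = - R\<zeta> + w * (Xz - X\<zeta>) - z * (w * (Rz - R\<zeta>))"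
      if "w * (z - \<zeta>) = 1" for w q' Xz Rz X\<zeta> R\<zeta> :: complex
      using that by algebra
    then show ?thesis
      unfolding cint_du[OF R that(1)] cint_du[OF X that(1)] dv_def eqv[OF that(1)]
      using that(2) by simp
  qed
  obtain B where B: "\<And>t. t \<in> {\<alpha>..\<beta>} \<Longrightarrow> norm (u \<zeta> t) \<le> B"
    using u[of \<zeta>] unfolding bounded_borel_on_def by blast
  have B1: "norm (du z t) + norm (dv z t) \<le> B * mR * K" if z: "z \<in> ball \<zeta> 1 - {\<zeta>}" and t: "t \<in> {\<alpha>..\<beta>}" for z t
  proof (rule bound[OF z du dv _ _ _ t])
    show "norm (- cint rho c s (u \<zeta>)) \<le> B * mR" if "s \<in> {\<alpha>..\<beta>}" for s
      using norm_cint_le_bound[OF R u c that B] by (simp add: mR_def)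
  qed (use eq_du eq_dv z in auto)
  have lip: "norm (du z x - du z' x) + norm (dv z x - dv z' x) \<le> norm (z - z') * (B * mR * K * mR * K)"
    if z: "z \<in> ball \<zeta> 1 - {\<zeta>}" and z': "z' \<in> ball \<zeta> 1 - {\<zeta>}" for z z'
  proof -
    have ne: "z \<noteq> \<zeta>" "z' \<noteq> \<zeta>" using z z' by auto
    have "norm (du z x - du z' x) + norm (dv z x - dv z' x) \<le> (norm (z - z') * (B * mR * K * mR)) * K"
    proof (rule bound[OF z bounded_borel_on_diff[OF du du] bounded_borel_on_diff[OF dv dv] _ _ _ x])
      fix t assume t: "t \<in> {\<alpha>..\<beta>}"
      show "du z t - du z' t = cint vsig c t (\<lambda>x. dv z x - dv z' x)"
        unfolding cint_diff[OF S c t i[OF S dv] i[OF S dv]] by (simp add: eq_du[OF t])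
      \<comment> \<open>The source common to both quotients cancels; what remains comes from writing
        the second coefficient as \<open>z' = z - (z - z')\<close>.\<close>
      show "dv z t - dv z' t = - (z - z') * cint rho c t (du z')
          + cint chi c t (\<lambda>x. du z x - du z' x) - z * cint rho c t (\<lambda>x. du z x - du z' x)"
        unfolding cint_diff[OF X c t i[OF X du] i[OF X du]] cint_diff[OF R c t i[OF R du] i[OF R du]]
        by (simp add: eq_dv[OF t ne(1)] eq_dv[OF t ne(2)] algebra_simps)
      have "norm (cint rho c t (du z')) \<le> B * mR * K * mR"
      proof (rule norm_cint_le_bound[OF R du c t, folded mR_def])
        show "norm (du z' s) \<le> B * mR * K" if "s \<in> {\<alpha>..\<beta>}" for s
          using B1[OF z' that] norm_ge_zero[of "dv z' s"] by linarith
      qed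
      then show "norm (- (z - z') * cint rho c t (du z')) \<le> norm (z - z') * (B * mR * K * mR)"
        unfolding norm_mult norm_minus_cancel by (intro mult_left_mono) auto
    qed
    then show ?thesis by (simp add: mult.assoc)
  qed
  have q: "(u z x - u \<zeta> x) / (z - \<zeta>) = du z x" "(v z x - v \<zeta> x) / (z - \<zeta>) = dv z x" for z
    by (simp_all add: du_def dv_def divide_inverse mult.commute)
  show "(\<lambda>z. u z x) field_differentiable at \<zeta>"
  proof (rule quotient_lipschitz_imp_field_differentiable, unfold q)
    fix z z' assume "z \<in> ball \<zeta> 1 - {\<zeta>}" "z' \<in> ball \<zeta> 1 - {\<zeta>}"
    from lip[OF this] show "norm (du z x - du z' x) \<le> norm (z - z') * (B * mR * K * mR * K)"
      using norm_ge_zero[of "dv z x - dv z' x"] by linarith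
  qed
  show "(\<lambda>z. v z x) field_differentiable at \<zeta>"
  proof (rule quotient_lipschitz_imp_field_differentiable, unfold q)
    fix z z' assume "z \<in> ball \<zeta> 1 - {\<zeta>}" "z' \<in> ball \<zeta> 1 - {\<zeta>}"
    from lip[OF this] show "norm (dv z x - dv z' x) \<le> norm (z - z') * (B * mR * K * mR * K)"
      using norm_ge_zero[of "du z x - du z' x"] by linarith
  qed
qed

text \<open>Eliminates \<open>F\<close> and both densities. The quasi-derivative is a version of the
  density \<open>h\<close> of \<open>f\<close> with respect to \<open>vsig\<close>, and the density
  \<open>k\<close> of \<open>F\<close> is \<open>z * f + g\<close>; equality almost everywhere is
  enough under \<open>cint\<close>. The integral of \<open>g\<close> joins the source, which does
  not depend on \<open>z\<close>.\<close>

lemma ivp_solution_system: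
  assumes sol: "is_ivp_solution I rho vsig chi c g z d1 d2 f F"
    and sub: "{\<alpha>..\<beta>} \<subseteq> I" and c: "c \<in> {\<alpha>..\<beta>}"
    and R: "cm_on \<alpha> \<beta> rho" and S: "cm_on \<alpha> \<beta> vsig" and X: "cm_on \<alpha> \<beta> chi"
    and g: "set_integrable (fst rho) {\<alpha>..\<beta>} g"
  defines "f1 \<equiv> quasi_deriv chi c f F"
  shows "bounded_borel_on \<alpha> \<beta> f" "bounded_borel_on \<alpha> \<beta> f1"
    and "\<And>x. x \<in> {\<alpha>..\<beta>} \<Longrightarrow> f x = d1 + cint vsig c x f1"
    and "\<And>x. x \<in> {\<alpha>..\<beta>} \<Longrightarrow> f1 x = (d2 - cint rho c x g) + cint chi c x f - z * cint rho c x f"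
proof -
  obtain h k where h: "ac_density I vsig c f h" and k: "ac_density I rho c F k"
    and Fh: "AE x in fst vsig. x \<in> I \<longrightarrow> F x = - h x + cint chi c x f"
    and kz: "AE x in fst rho. x \<in> I \<longrightarrow> k x - z * f x = g x"
    and fc: "f c = d1" and qc: "quasi_deriv chi c f F c = d2"
    using sol by (auto simp: is_ivp_solution_def)
  have ends: "\<alpha> \<in> I" "\<beta> \<in> I" using sub c by auto
  have hi: "set_integrable (fst vsig) {\<alpha>..\<beta>} h" and ki: "set_integrable (fst rho) {\<alpha>..\<beta>} k"
    using h k ends by (simp_all add: ac_density_def loc_L1_def)
  \<comment> \<open>Since \<open>cint\<close> vanishes at its base point, the second initial
    condition reads \<open>F c = - d2\<close>.\<close>
  have f_eq: "f x = d1 + cint vsig c x h" and F_eq: "F x = - d2 + cint rho c x k" if "x \<in> {\<alpha>..\<beta>}" for x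
    using h k that sub fc qc by (auto simp: ac_density_def quasi_deriv_def)
  have i: "set_integrable (fst \<mu>) {\<alpha>..\<beta>} w" if "cm_on \<alpha> \<beta> \<mu>" "bounded_borel_on \<alpha> \<beta> w" for \<mu> w
    using bounded_borel_on_set_integrable that by (auto simp: cm_on_def)
  show f: "bounded_borel_on \<alpha> \<beta> f"
    using bounded_borel_on_add[OF bounded_borel_on_const bounded_borel_on_cint[OF S c hi]] f_eq
    by (rule bounded_borel_on_cong)
  have F: "bounded_borel_on \<alpha> \<beta> F"
    using bounded_borel_on_add[OF bounded_borel_on_const bounded_borel_on_cint[OF R c ki]] F_eq
    by (rule bounded_borel_on_cong)
  show f1: "bounded_borel_on \<alpha> \<beta> f1"
    using bounded_borel_on_diff[OF bounded_borel_on_cint[OF X c i[OF X f]] F]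
    by (simp add: f1_def quasi_deriv_def[abs_def])
  fix x assume x: "x \<in> {\<alpha>..\<beta>}"
  have "AE t in fst vsig. t \<in> {\<alpha>..\<beta>} \<longrightarrow> h t = f1 t"
    using Fh by eventually_elim (use sub in \<open>auto simp: f1_def quasi_deriv_def\<close>)
  from cint_cong_AE[OF S c x hi i[OF S f1] this] show "f x = d1 + cint vsig c x f1"
    using f_eq[OF x] by simp
  have zf: "set_integrable (fst rho) {\<alpha>..\<beta>} (\<lambda>t. z * f t)"
    by (rule i[OF R bounded_borel_on_mult[OF f]])
  have "AE t in fst rho. t \<in> {\<alpha>..\<beta>} \<longrightarrow> k t = z * f t + g t"
    using kz by eventually_elim (use sub in \<open>auto simp: algebra_simps\<close>)
  from cint_cong_AE[OF R c x ki set_integral_add(1)[OF zf g] this]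
  have "cint rho c x k = z * cint rho c x f + cint rho c x g"
    by (simp add: cint_add[OF R c x zf g] cint_mult)
  then show "f1 x = (d2 - cint rho c x g) + cint chi c x f - z * cint rho c x f"
    by (simp add: f1_def quasi_deriv_def F_eq[OF x])
qed

theorem theorem3p6:
  fixes a b :: ereal and rho vsig chi :: cmeasure
    and g :: "real \<Rightarrow> complex" and c :: real and d1 d2 :: complex
    and f F :: "complex \<Rightarrow> real \<Rightarrow> complex"
  defines "I \<equiv> ointerval a b"
  assumes "a < b"
    and "loc_fin_cmeasure I rho" and "loc_fin_cmeasure I vsig" and "loc_fin_cmeasure I chi"
    and "cm_support I vsig = I"
    and "\<And>x. x \<in> I \<Longrightarrow> cmeasure_val vsig {x} * cmeasure_val rho {x} = 0"
    and "\<And>x. x \<in> I \<Longrightarrow> cmeasure_val vsig {x} * cmeasure_val chi {x} = 0"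
    and "loc_L1 I rho g"
    and "c \<in> I"
    and sol: "\<And>z. is_ivp_solution I rho vsig chi c g z d1 d2 (f z) (F z)"
  shows "(\<forall>x\<in>I. (\<lambda>z. f z x) holomorphic_on UNIV \<and> entire_order (\<lambda>z. f z x) \<le> ereal (1/2) \<and>
                 (\<lambda>z. quasi_deriv chi c (f z) (F z) x) holomorphic_on UNIV \<and>
                 entire_order (\<lambda>z. quasi_deriv chi c (f z) (F z) x) \<le> ereal (1/2)) \<and>
         (\<forall>\<alpha>\<in>I. \<forall>\<beta>\<in>I. \<alpha> < \<beta> \<longrightarrow>
            (\<exists>C B::real. \<forall>x\<in>{\<alpha>..\<beta>}. \<forall>z.
               norm (f z x) + norm (quasi_deriv chi c (f z) (F z) x) \<le> C * exp (B * sqrt (norm z))))"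
proof -
  let ?f1 = "\<lambda>z. quasi_deriv chi c (f z) (F z)"
  have bound: "(\<exists>C B. \<forall>x\<in>{\<alpha>..\<beta>}. \<forall>z. norm (f z x) + norm (?f1 z x) \<le> C * exp (B * sqrt (norm z))) \<and>
      (\<forall>x\<in>{\<alpha>..\<beta>}. (\<lambda>z. f z x) holomorphic_on UNIV \<and> (\<lambda>z. ?f1 z x) holomorphic_on UNIV)"
    if "\<alpha> \<in> I" "\<beta> \<in> I" for \<alpha> \<beta>
  proof -
    \<comment> \<open>The equations are based at \<open>c\<close>, so the interval is enlarged to
      contain it.\<close>
    define l r where "l = min \<alpha> c" and "r = max \<beta> c"
    have lr: "l \<in> I" "r \<in> I" and c: "c \<in> {l..r}" and sub: "{\<alpha>..\<beta>} \<subseteq> {l..r}"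
      using that \<open>c \<in> I\<close> by (auto simp: l_def r_def min_def max_def)
    have I: "{l..r} \<subseteq> I" using ointerval_subset lr unfolding I_def by blast
    have R: "cm_on l r rho" and S: "cm_on l r vsig" and X: "cm_on l r chi"
      using loc_fin_cmeasure_imp_cm_on assms(3-5) lr unfolding I_def by blast+
    have g: "set_integrable (fst rho) {l..r} g" using \<open>loc_L1 I rho g\<close> lr by (simp add: loc_L1_def)
    have SR: "\<And>x. x \<in> {l..r} \<Longrightarrow> cmeasure_val vsig {x} * cmeasure_val rho {x} = 0"
      and SX: "\<And>x. x \<in> {l..r} \<Longrightarrow> cmeasure_val vsig {x} * cmeasure_val chi {x} = 0"
      using assms(7,8) I by blast+
    note sys = ivp_solution_system[OF sol I c R S X g]
    define T where "T = measure (fst vsig) {l..r} + measure (fst chi) {l..r} + measure (fst rho) {l..r}"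
    \<comment> \<open>Bounds the source by the total integral of \<open>g\<close> against the
      variation of \<open>rho\<close>; being free of \<open>z\<close>, it can enter the constant
      \<open>C\<close>.\<close>
    define Q where "Q = norm d2 + (LINT t:{l..r}|fst rho. norm (g t))"
    have Q: "norm (d2 - cint rho c x g) \<le> Q" if "x \<in> {l..r}" for x
      using norm_cint_le[OF R g c that] norm_triangle_ineq4[of d2 "cint rho c x g"]
      unfolding Q_def by linarith
    have "norm (f z x) + norm (?f1 z x)
        \<le> ((norm d1 + Q) * ((1 + T) * exp (3 + 2 * T))) * exp ((3 + 2 * T) * sqrt (norm z))"
      if "x \<in> {l..r}" for x z
      using system_bound[OF R S X SR SX sys(1,2) c sys(3,4) _ Q that, of "norm d1" z]
      unfolding T_def[symmetric] by (simp add: mult.assoc)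
    then have "\<forall>x\<in>{\<alpha>..\<beta>}. \<forall>z. norm (f z x) + norm (?f1 z x)
        \<le> ((norm d1 + Q) * ((1 + T) * exp (3 + 2 * T))) * exp ((3 + 2 * T) * sqrt (norm z))"
      using sub by blast
    moreover have "(\<lambda>z. f z x) holomorphic_on UNIV \<and> (\<lambda>z. ?f1 z x) holomorphic_on UNIV"
      if "x \<in> {l..r}" for x
      using system_family_differentiable[OF R S X SR SX sys(1,2) c sys(3,4) that]
      by (simp add: holomorphic_on_def)
    ultimately show ?thesis using sub by blast
  qed
  have "entire_order (\<lambda>z. f z x) \<le> ereal (1/2) \<and> entire_order (\<lambda>z. ?f1 z x) \<le> ereal (1/2)"
    if x: "x \<in> I" for x
  proof -
    \<comment> \<open>The degenerate interval from \<open>x\<close> to \<open>x\<close> turns the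
      locally uniform bound into a pointwise one.\<close>
    obtain C B where CB: "\<And>z. norm (f z x) + norm (?f1 z x) \<le> C * exp (B * sqrt (norm z))"
      using bound[OF x x] by auto
    have "norm (f z x) \<le> C * exp (B * sqrt (norm z))" "norm (?f1 z x) \<le> C * exp (B * sqrt (norm z))" for z
      using CB[of z] norm_ge_zero[of "f z x"] norm_ge_zero[of "?f1 z x"] by linarith+
    then show ?thesis by (intro conjI entire_order_le_half)
  qed
  then show ?thesis using bound by (meson atLeastAtMost_iff order_refl)
qed

end
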